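(* For $q\in\mathbb{C}$ with $|q|<1$, set \begin{align*} P(q)&=1+ 10 \sum_{n=1}^{\infty} (d_{2,5}(n)-d_{3,5}(n)) q^n, \\ Q(q)&=3 + 10\sum_{n=1}^{\infty} (d_{1,5}(n)-d_{4,5}(n)) q^n, \\ R(q)&=E_2(q^5)=1-24\sum_{n=1}^{\infty} \sigma_1(n) q^{5n}. \end{align*} Then \begin{align*} q\frac{d}{dq}P&=\frac{13P^3+39P^2Q-47PQ^2+9Q^3+50PR}{120}, \\ q\frac{d}{dq}Q&=\frac{-9P^3-47P^2Q-39PQ^2+13Q^3+50QR}{120}, \\ q\frac{d}{dq}R&=\frac{P^4-3P^3Q-31P^2Q^2+3PQ^3+Q^4+125R^2}{300}. \end{align*}
   Context: For a positive integer $n$, $\sigma_1(n)$ is the sum of the positive divisors of $n$, and $d_{j,5}(n)$ is the number of positive divisors $d$ of $n$ with $d\equiv j \pmod 5$. Here $E_2(q)=1-24\sum_{n\ge 1}\sigma_1(n)q^n$. *)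

theory Defs
  imports "HOL-Analysis.Analysis" "HOL-Number_Theory.Cong"
begin

definition sigma1 :: "nat \<Rightarrow> nat" where
  "sigma1 n = \<Sum>{d. d > 0 \<and> d dvd n}"

definition divisor_count_mod :: "nat \<Rightarrow> nat \<Rightarrow> nat \<Rightarrow> nat" where
  "divisor_count_mod j m n = card {d. d > 0 \<and> d dvd n \<and> [d = j] (mod m)}"

text \<open>
  The sums over \<open>n \<ge> 1\<close> below are written with the index shifted to \<open>Suc n\<close>. Differences of
  divisor counts can be negative, so they are formed in the complex numbers.
\<close>

definition E2 :: "complex \<Rightarrow> complex" where
  "E2 q = 1 - 24 * (\<Sum>n. of_nat (sigma1 (Suc n)) * q ^ Suc n)"

definition Pser :: "complex \<Rightarrow> complex" where
  "Pser q = 1 + 10 * (\<Sum>n. (of_nat (divisor_count_mod 2 5 (Suc n))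
                        - of_nat (divisor_count_mod 3 5 (Suc n))) * q ^ Suc n)"

definition Qser :: "complex \<Rightarrow> complex" where
  "Qser q = 3 + 10 * (\<Sum>n. (of_nat (divisor_count_mod 1 5 (Suc n))
                        - of_nat (divisor_count_mod 4 5 (Suc n))) * q ^ Suc n)"

definition Rser :: "complex \<Rightarrow> complex" where
  "Rser q = E2 (q ^ 5)"

end

theory Submission
  imports Defs
begin

text \<open>
  The function \<open>\<zeta>(x) = 1/2 + \<Sum>\<^sub>n x\<^sup>n / (1 - q\<^sup>n)\<close>, summed over the nonzero integers \<open>n\<close> and
  defined for \<open>|q| < |x| < 1\<close>, satisfies
  \<open>\<zeta>(x) \<zeta>(y) - \<zeta>(xy) (\<zeta>(x) + \<zeta>(y)) = - 1/4 + G(x) + G(y) + G(xy)\<close> with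
  \<open>G(x) = \<Sum>\<^sub>n q\<^sup>n x\<^sup>n / (1 - q\<^sup>n)\<^sup>2\<close>. Comparing coefficients of \<open>x\<^sup>m y\<^sup>n\<close>, this is the partial
  fraction identity for \<open>1 / ((1 - u) (1 - v))\<close>. Since \<open>x (d/dx) G = q (d/dq) \<zeta>\<close>, differentiating
  the identity in \<open>x\<close> and \<open>y\<close> and letting \<open>x\<close> and \<open>y\<close> tend radially to fifth roots of unity expresses
  the \<open>q\<close>-derivatives of \<open>\<zeta>(\<omega>)\<close>, \<open>\<zeta>(\<omega>\<^sup>2)\<close> and \<open>x \<zeta>'(x)\<close> at \<open>x = \<omega>\<^sup>2\<close> through their values. The limit
  \<open>y \<rightarrow> 1\<close> gives \<open>x \<zeta>' = \<zeta>\<^sup>2 - 1/4 + 2 G(x) + G(1)\<close>, and \<open>\<Sum>\<^sub>k G(\<omega>\<^sup>k) = 5 (1 - R) / 12\<close>; hence everything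
  is a polynomial in \<open>\<zeta>(\<omega>)\<close>, \<open>\<zeta>(\<omega>\<^sup>2)\<close> and \<open>R\<close>. The first two are linear combinations of \<open>P\<close> and \<open>Q\<close>.
\<close>

subsection \<open>Power series under iterates of \<open>x d/dx\<close>\<close>

definition summable_below :: "real \<Rightarrow> (nat \<Rightarrow> complex) \<Rightarrow> bool" where
  "summable_below r c \<longleftrightarrow> (\<forall>x. norm x < r \<longrightarrow> summable (\<lambda>n. c n * x ^ n))"

text \<open>The \<open>k\<close>-th iterate of x d/dx on a power series. Since
  \<open>0 ^ 0 = 1\<close>, the constant term survives for \<open>k = 0\<close> only.\<close>

definition euler_series :: "nat \<Rightarrow> (nat \<Rightarrow> complex) \<Rightarrow> complex \<Rightarrow> complex" where
  "euler_series k c x = (\<Sum>n. of_nat n ^ k * c n * x ^ n)"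

lemma summable_below_euler:
  assumes "summable_below r c"
  shows "summable_below r (\<lambda>n. of_nat n ^ k * c n)"
proof (induction k)
  case 0
  then show ?case using assms by simp
next
  case (Suc k)
  let ?d = "\<lambda>n. of_nat n ^ k * c n"
  show ?case unfolding summable_below_def
  proof (intro allI impI)
    fix x :: complex assume x: "norm x < r"
    have "summable (\<lambda>n. diffs ?d n * x ^ n)"
      using termdiff_converges[OF x, of ?d] Suc unfolding summable_below_def by blast
    then have "summable (\<lambda>n. (diffs ?d n * x ^ n) * x)"
      by (rule summable_mult2)
    then have "summable (\<lambda>n. (of_nat (Suc n) ^ Suc k * c (Suc n)) * x ^ Suc n)"
      by (simp add: diffs_def mult_ac)
    then show "summable (\<lambda>n. (of_nat n ^ Suc k * c n) * x ^ n)"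
      by (subst (asm) summable_Suc_iff)
  qed
qed

lemma summable_below_abs:
  assumes "summable_below r c" "norm x < r"
  shows "summable (\<lambda>n. norm (of_nat n ^ k * c n * x ^ n))"
proof -
  \<comment> \<open>A radius strictly between \<open>norm x\<close> and \<open>r\<close>:
    convergence at \<open>K\<close> forces absolute convergence at \<open>x\<close>.\<close>
  define K where "K = (norm x + r) / 2"
  have K: "norm x < K" "K < r" "0 \<le> K"
    using assms(2) norm_ge_zero[of x] unfolding K_def by (simp_all del: norm_ge_zero)
  have "summable (\<lambda>n. of_nat n ^ k * c n * complex_of_real K ^ n)"
    using summable_below_euler[OF assms(1), of k] K unfolding summable_below_def
    by (simp add: norm_of_real)
  then show ?thesis
    by (rule powser_insidea) (use K in simp)
qed

lemma euler_series_sums: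
  assumes "summable_below r c" "norm x < r"
  shows "(\<lambda>n. of_nat n ^ k * c n * x ^ n) sums euler_series k c x"
  unfolding euler_series_def
  by (rule summable_sums) (rule summable_norm_cancel[OF summable_below_abs[OF assms]])

lemma euler_series_has_sum:
  assumes "summable_below r c" "norm x < r"
  shows "((\<lambda>n. of_nat n ^ k * c n * x ^ n) has_sum euler_series k c x) UNIV"
  using norm_summable_imp_has_sum[OF summable_below_abs[OF assms] euler_series_sums[OF assms]] .

text \<open>Phrased through \<open>x * D\<close> instead of a quotient so that it also covers
  \<open>x = 0\<close>; later this allows the nome \<open>q = 0\<close>.\<close>

lemma euler_series_deriv_ex:
  assumes "summable_below r c" "norm x < r"
  shows "\<exists>D. (euler_series k c has_field_derivative D) (at x) \<and> x * D = euler_series (Suc k) c x"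
proof -
  let ?d = "\<lambda>n. of_nat n ^ k * c n"
  let ?D = "\<Sum>n. diffs ?d n * x ^ n"
  have sb: "\<And>z. norm z < r \<Longrightarrow> summable (\<lambda>n. ?d n * z ^ n)"
    using summable_below_euler[OF assms(1)] unfolding summable_below_def by blast
  have "(euler_series k c has_field_derivative ?D) (at x)"
    using termdiffs_strong'[OF sb assms(2)] unfolding euler_series_def .
  moreover have "x * ?D = euler_series (Suc k) c x"
  proof -
    have "summable (\<lambda>n. diffs ?d n * x ^ n)"
      by (rule termdiff_converges[OF assms(2) sb])
    then have "(\<lambda>n. x * (diffs ?d n * x ^ n)) sums (x * ?D)"
      by (intro sums_mult summable_sums)
    then have "(\<lambda>n. of_nat (Suc n) ^ Suc k * c (Suc n) * x ^ Suc n) sums (x * ?D)"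
      by (simp add: diffs_def mult_ac)
    then have "(\<lambda>n. of_nat n ^ Suc k * c n * x ^ n) sums (x * ?D)"
      by (subst (asm) sums_Suc_iff) simp
    then show ?thesis
      unfolding euler_series_def by (simp add: sums_iff)
  qed
  ultimately show ?thesis by blast
qed

lemma euler_series_has_field_derivative:
  assumes "summable_below r c" "norm x < r" "x \<noteq> 0"
  shows "(euler_series k c has_field_derivative euler_series (Suc k) c x / x) (at x)"
proof -
  obtain D where D: "(euler_series k c has_field_derivative D) (at x)" "x * D = euler_series (Suc k) c x"
    using euler_series_deriv_ex[OF assms(1,2)] by blast
  from D(2) assms(3) have "euler_series (Suc k) c x / x = D"
    by (simp add: field_simps)
  with D(1) show ?thesis by simp
qed

text \<open>x d/dx changes sign under x -> 1/x, hence the alternating signs of the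
  \<open>1 / x\<close> terms in \<open>zeta0\<close>, \<open>zeta1\<close>,
  \<open>zeta2\<close>.\<close>

lemma euler_series_has_field_derivative_inverse:
  assumes "summable_below r c" "norm (1 / x) < r" "x \<noteq> 0"
  shows "((\<lambda>x. euler_series k c (1 / x)) has_field_derivative - euler_series (Suc k) c (1 / x) / x) (at x)"
proof -
  have "((\<lambda>x. 1 / x) has_field_derivative - (1 / x ^ 2)) (at x)"
    using assms(3) by (auto intro!: derivative_eq_intros simp: power2_eq_square)
  from DERIV_chain2[OF euler_series_has_field_derivative[OF assms(1,2), of k] this]
  show ?thesis using assms(3) by (simp add: power2_eq_square)
qed

lemma summable_below_bounded:
  assumes "\<And>n. norm (c n) \<le> C * \<rho> ^ n" "0 < \<rho>"
  shows "summable_below (1 / \<rho>) c"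
  unfolding summable_below_def
proof (intro allI impI)
  fix x :: complex assume x: "norm x < 1 / \<rho>"
  show "summable (\<lambda>n. c n * x ^ n)"
  proof (rule summable_comparison_test')
    show "summable (\<lambda>n. C * (\<rho> * norm x) ^ n)"
      using x assms(2) by (intro summable_mult summable_geometric) (simp add: field_simps)
    fix n show "norm (c n * x ^ n) \<le> C * (\<rho> * norm x) ^ n"
      using mult_right_mono[OF assms(1)[of n], of "norm x ^ n"]
      by (simp add: norm_mult norm_power power_mult_distrib mult_ac)
  qed
qed

section \<open>Convergence of Lambert series in the variable x\<close>

lemma norm_one_minus_power_ge:
  fixes q :: complex
  assumes "norm q < 1" "n > 0"
  shows "1 - norm q \<le> norm (1 - q ^ n)"
proof -
  have "norm (q ^ n) \<le> norm q"
    using power_decreasing[of 1 n "norm q"] assms by (simp add: norm_power)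
  with norm_triangle_ineq2[of 1 "q ^ n"] show ?thesis by simp
qed

text \<open>At \<open>n = 0\<close> the coefficient is \<open>1 / 0 = 0\<close>, so the sums below start at \<open>n = 1\<close>.\<close>

definition lambert_coeff :: "complex \<Rightarrow> nat \<Rightarrow> nat \<Rightarrow> complex" where
  "lambert_coeff q i n = q ^ n / (1 - q ^ n) ^ Suc i"

lemma norm_lambert_coeff_le:
  assumes "norm q < 1"
  shows "norm (lambert_coeff q i n) \<le> 1 / (1 - norm q) ^ Suc i * norm q ^ n"
proof (cases "n = 0")
  case False
  then have "(1 - norm q) ^ Suc i \<le> norm (1 - q ^ n) ^ Suc i"
    using assms norm_one_minus_power_ge[OF assms, of n] by (intro power_mono) auto
  moreover have "(1 - norm q) ^ Suc i > 0" using assms by (intro zero_less_power) simp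
  ultimately have "norm q ^ n / norm (1 - q ^ n) ^ Suc i \<le> norm q ^ n / (1 - norm q) ^ Suc i"
    by (intro divide_left_mono mult_pos_pos) auto
  then show ?thesis
    by (simp add: lambert_coeff_def norm_divide norm_power norm_mult)
qed (use assms in \<open>simp add: lambert_coeff_def\<close>)

text \<open>The factor q^n in the numerator pushes the radius of convergence beyond the unit circle,
  which makes boundary values accessible.\<close>

lemma summable_below_lambert:
  assumes "0 < norm q" "norm q < 1"
  shows "summable_below (1 / norm q) (lambert_coeff q i)"
  using summable_below_bounded[OF norm_lambert_coeff_le[OF assms(2)] assms(1)] .

subsection \<open>The addition identity\<close>

text \<open>The two half-lines share the index 0; \<open>h 0 = 0\<close> makes the overlap
  harmless.\<close>

lemma has_sum_int:
  fixes h :: "int \<Rightarrow> complex"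
  assumes "((\<lambda>n. h (int n)) has_sum a) UNIV" "((\<lambda>n. h (- int n)) has_sum b) UNIV" "h 0 = 0"
  shows "(h has_sum (a + b)) UNIV"
proof -
  have "(h has_sum a) (range int)"
    using assms(1) by (subst has_sum_reindex) (auto simp: o_def)
  moreover have "(h has_sum b) ((\<lambda>n. - int n) ` {1..})"
  proof (subst has_sum_reindex)
    show "inj_on (\<lambda>n. - int n) {1..}" by (auto simp: inj_on_def)
    have "((\<lambda>n. h (- int n)) has_sum b) UNIV \<longleftrightarrow> ((\<lambda>n. h (- int n)) has_sum b) {1..}"
      by (rule has_sum_cong_neutral) (use assms(3) in \<open>auto simp: not_le\<close>)
    then show "((h \<circ> (\<lambda>n. - int n)) has_sum b) {1..}"
      using assms(2) by (simp add: o_def)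
  qed
  moreover have "range int \<union> (\<lambda>n. - int n) ` {1..} = UNIV"
  proof -
    have "m \<in> range int \<union> (\<lambda>n. - int n) ` {1..}" for m :: int
    proof (cases "m \<ge> 0")
      case True
      then have "m = int (nat m)" by simp
      then show ?thesis by blast
    next
      case False
      then have "m = - int (nat (- m))" "nat (- m) \<in> {1..}" by auto
      then show ?thesis by blast
    qed
    then show ?thesis by blast
  qed
  moreover have "range int \<inter> (\<lambda>n. - int n) ` {1..} = {}" by auto
  ultimately show ?thesis using has_sum_Un_disjoint by metis
qed

text \<open>Summability of complex families is absolute, so the product family is summable on
  \<open>A \<times> B\<close> and may be summed one variable at a time.\<close>

lemma has_sum_product_complex:
  fixes f :: "'a \<Rightarrow> complex" and g :: "'b \<Rightarrow> complex"
  assumes "(f has_sum a) A" "(g has_sum b) B"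
  shows "((\<lambda>(m, n). f m * g n) has_sum (a * b)) (A \<times> B)"
proof (rule has_sum_SigmaI)
  show "((\<lambda>n. case (m, n) of (m, n) \<Rightarrow> f m * g n) has_sum f m * b) B" for m
    using has_sum_cmult_right[OF assms(2)] by simp
  show "((\<lambda>m. f m * b) has_sum a * b) A"
    using has_sum_cmult_left[OF assms(1)] by simp
  have fa: "(\<lambda>m. norm (f m)) summable_on A" and gb: "(\<lambda>n. norm (g n)) summable_on B"
    using assms has_sum_imp_summable summable_on_iff_abs_summable_on_complex by blast+
  have "(\<lambda>(m, n). norm (f m) * norm (g n)) summable_on (A \<times> B)"
    by (rule summable_on_SigmaI[where g = "\<lambda>m. norm (f m) * infsum (\<lambda>n. norm (g n)) B"])
      (use fa gb in \<open>auto intro!: has_sum_cmult_right summable_on_cmult_left\<close>)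
  then have "(\<lambda>x. norm ((\<lambda>(m, n). f m * g n) x)) summable_on (A \<times> B)"
    by (simp add: case_prod_unfold norm_mult)
  then show "(\<lambda>(m, n). f m * g n) summable_on (A \<times> B)"
    by (rule abs_summable_summable)
qed

text \<open>Here too the coefficients at \<open>n = 0\<close> are \<open>1 / 0 = 0\<close>.\<close>

definition bilateral_coeff :: "complex \<Rightarrow> int \<Rightarrow> complex" where
  "bilateral_coeff q n = 1 / (1 - q powi n)"

definition bilateral_coeff2 :: "complex \<Rightarrow> int \<Rightarrow> complex" where
  "bilateral_coeff2 q n = q powi n / (1 - q powi n) ^ 2"

text \<open>
  Splitting off the geometric part of \<open>\<Sum>\<^sub>n x\<^sup>n / (1 - q\<^sup>n)\<close> continues \<open>\<zeta>\<close> to the annulus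
  \<open>|q| < |x| < 1 / |q|\<close> without \<open>1\<close>; \<open>zeta1\<close> and \<open>zeta2\<close> are its first two iterates under \<open>x d/dx\<close>.
\<close>

definition zeta0 :: "complex \<Rightarrow> complex \<Rightarrow> complex" where
  "zeta0 q x = 1 / 2 + x / (1 - x)
     + euler_series 0 (lambert_coeff q 0) x - euler_series 0 (lambert_coeff q 0) (1 / x)"

definition zeta1 :: "complex \<Rightarrow> complex \<Rightarrow> complex" where
  "zeta1 q x = x / (1 - x) ^ 2
     + euler_series 1 (lambert_coeff q 0) x + euler_series 1 (lambert_coeff q 0) (1 / x)"

definition zeta2 :: "complex \<Rightarrow> complex \<Rightarrow> complex" where
  "zeta2 q x = x * (1 + x) / (1 - x) ^ 3
     + euler_series 2 (lambert_coeff q 0) x - euler_series 2 (lambert_coeff q 0) (1 / x)"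

text \<open>The \<open>k\<close>-th x d/dx iterate of G. Its coefficients are even in n, so the
  negative indices give the same series at \<open>1 / x\<close>, with one sign per
  derivative.\<close>

definition bilateral_sum2 :: "nat \<Rightarrow> complex \<Rightarrow> complex \<Rightarrow> complex" where
  "bilateral_sum2 k q x = euler_series k (lambert_coeff q 1) x
     + (- 1) ^ k * euler_series k (lambert_coeff q 1) (1 / x)"

context
  fixes q :: complex
  assumes q0: "0 < norm q" and q1: "norm q < 1"
begin

lemma annulus_bounds:
  fixes x :: complex
  assumes "norm q < norm x" "norm x \<le> 1"
  shows "x \<noteq> 0" "norm x < 1 / norm q" "norm (1 / x) < 1 / norm q"
proof -
  show "x \<noteq> 0" using assms by auto
  have "1 < 1 / norm q" using q0 q1 by (simp add: field_simps)
  then show "norm x < 1 / norm q" using assms by linarith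
  show "norm (1 / x) < 1 / norm q" using assms q0
    by (simp add: norm_divide) (intro frac_less2, auto)
qed

lemma power_ne_1: "n > 0 \<Longrightarrow> q ^ n \<noteq> 1"
  using norm_one_minus_power_ge[OF q1, of n] q1 by auto

lemma powi_ne_1: "n \<noteq> 0 \<Longrightarrow> q powi n \<noteq> 1"
  using power_ne_1[of "nat \<bar>n\<bar>"] by (auto simp: power_int_def power_inverse)

text \<open>For n > 0, 1/(1 - q^n) = 1 + q^n/(1 - q^n), and the ones sum to x/(1 - x); at the index
  -n the coefficient is -q^n/(1 - q^n).\<close>

lemma has_sum_bilateral_coeff:
  assumes x: "norm q < norm x" "norm x < 1"
  shows "((\<lambda>n. bilateral_coeff q n * x powi n) has_sum (zeta0 q x - 1 / 2)) UNIV"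
proof -
  let ?E = "euler_series 0 (lambert_coeff q 0)"
  note b = annulus_bounds[OF x(1) less_imp_le[OF x(2)]]
  have "((\<lambda>n. x ^ n) has_sum (x / (1 - x))) {1..}"
    by (rule has_sum_geometric_from_1) (use x in simp)
  also have "?this \<longleftrightarrow> ((\<lambda>n. if n = 0 then 0 else x ^ n) has_sum (x / (1 - x))) UNIV"
    by (rule has_sum_cong_neutral) auto
  finally have "((\<lambda>n. (if n = 0 then 0 else x ^ n) + of_nat n ^ 0 * lambert_coeff q 0 n * x ^ n)
      has_sum (x / (1 - x) + ?E x)) UNIV"
    by (rule has_sum_add) (rule euler_series_has_sum[OF summable_below_lambert[OF q0 q1] b(2)])
  moreover have "(if n = 0 then 0 else x ^ n) + of_nat n ^ 0 * lambert_coeff q 0 n * x ^ n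
      = bilateral_coeff q (int n) * x powi int n" for n
    using power_ne_1[of n] by (auto simp: lambert_coeff_def bilateral_coeff_def field_simps)
  ultimately have 1: "((\<lambda>n. bilateral_coeff q (int n) * x powi int n) has_sum (x / (1 - x) + ?E x)) UNIV"
    by simp
  have "((\<lambda>n. - (of_nat n ^ 0 * lambert_coeff q 0 n * (1 / x) ^ n)) has_sum - ?E (1 / x)) UNIV"
    by (rule has_sum_uminusI)
      (rule euler_series_has_sum[OF summable_below_lambert[OF q0 q1] b(3)])
  moreover have "- (of_nat n ^ 0 * lambert_coeff q 0 n * (1 / x) ^ n)
      = bilateral_coeff q (- int n) * x powi (- int n)" for n
    using power_ne_1[of n] q0 b(1)
    by (cases "n = 0") (auto simp: lambert_coeff_def bilateral_coeff_def power_int_minus field_simps)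
  ultimately have 2: "((\<lambda>n. bilateral_coeff q (- int n) * x powi (- int n)) has_sum - ?E (1 / x)) UNIV"
    by simp
  have "((\<lambda>n. bilateral_coeff q n * x powi n) has_sum (x / (1 - x) + ?E x + - ?E (1 / x))) UNIV"
    using has_sum_int[OF 1 2] by (simp add: bilateral_coeff_def)
  then show ?thesis by (simp add: zeta0_def algebra_simps)
qed

lemma has_sum_bilateral_coeff2:
  assumes x: "norm q < norm x" "norm x < 1"
  shows "((\<lambda>n. bilateral_coeff2 q n * x powi n) has_sum bilateral_sum2 0 q x) UNIV"
proof -
  let ?E = "euler_series 0 (lambert_coeff q 1)"
  note b = annulus_bounds[OF x(1) less_imp_le[OF x(2)]]
  have "((\<lambda>n. of_nat n ^ 0 * lambert_coeff q 1 n * x ^ n) has_sum ?E x) UNIV"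
    by (rule euler_series_has_sum[OF summable_below_lambert[OF q0 q1] b(2)])
  moreover have "of_nat n ^ 0 * lambert_coeff q 1 n * x ^ n
      = bilateral_coeff2 q (int n) * x powi int n" for n
    by (auto simp: lambert_coeff_def bilateral_coeff2_def power2_eq_square)
  ultimately have 1: "((\<lambda>n. bilateral_coeff2 q (int n) * x powi int n) has_sum ?E x) UNIV"
    by (simp only:)
  have "((\<lambda>n. of_nat n ^ 0 * lambert_coeff q 1 n * (1 / x) ^ n) has_sum ?E (1 / x)) UNIV"
    by (rule euler_series_has_sum[OF summable_below_lambert[OF q0 q1] b(3)])
  moreover have "of_nat n ^ 0 * lambert_coeff q 1 n * (1 / x) ^ n
      = bilateral_coeff2 q (- int n) * x powi (- int n)" for n
    using power_ne_1[of n] q0 b(1)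
    by (cases "n = 0") (auto simp: lambert_coeff_def bilateral_coeff2_def power_int_minus field_simps power2_eq_square)
  ultimately have 2: "((\<lambda>n. bilateral_coeff2 q (- int n) * x powi (- int n)) has_sum ?E (1 / x)) UNIV"
    by (simp only:)
  have "((\<lambda>n. bilateral_coeff2 q n * x powi n) has_sum (?E x + ?E (1 / x))) UNIV"
    using has_sum_int[OF 1 2] by (simp add: bilateral_coeff2_def)
  then show ?thesis by (simp add: bilateral_sum2_def)
qed

text \<open>Off the exceptional lines this splits 1/((1 - u)(1 - v)) with u = q^m, v = q^n, the
  cofactors 1/(1 - u/v) and 1/(1 - v/u) being the coefficients at m - n and n - m. On the lines m =
  n, n = 0, m = 0 some coefficients take the default value 0, and the right side comes from 1/(1 -
  v)^2 = 1/(1 - v) + v/(1 - v)^2 on the diagonal and from -1/((1 - u)(1 - 1/u)) = u/(1 - u)^2 on an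
  axis.\<close>

lemma bilateral_coeff_partial_fractions:
  "bilateral_coeff q m * bilateral_coeff q n
     - bilateral_coeff q n * bilateral_coeff q (m - n) - bilateral_coeff q m * bilateral_coeff q (n - m)
   = (if m = n then bilateral_coeff q n + bilateral_coeff2 q n else 0)
     + (if n = 0 then bilateral_coeff2 q m else 0) + (if m = 0 then bilateral_coeff2 q n else 0)"
proof -
  have qn0: "q \<noteq> 0" using q0 by auto
  consider "m = n" | "m \<noteq> n" "n = 0" | "m \<noteq> n" "m = 0" | "m \<noteq> n" "m \<noteq> 0" "n \<noteq> 0" by blast
  then show ?thesis
  proof cases
    case 1
    show ?thesis
    proof (cases "n = 0")
      case False
      then have "1 - q powi n \<noteq> 0" using powi_ne_1[of n] by auto
      with 1 False show ?thesis
        by (simp add: bilateral_coeff_def bilateral_coeff2_def divide_simps power2_eq_square)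
    qed (use 1 in \<open>simp add: bilateral_coeff_def bilateral_coeff2_def\<close>)
  next
    case 2
    then have "1 - q powi m \<noteq> 0" "q powi m \<noteq> 0" "q powi m - 1 \<noteq> 0" using powi_ne_1[of m] qn0 by auto
    with 2 show ?thesis using qn0
      by (simp add: bilateral_coeff_def bilateral_coeff2_def power_int_minus divide_simps power2_eq_square)
         (simp add: algebra_simps)
  next
    case 3
    then have "1 - q powi n \<noteq> 0" "q powi n \<noteq> 0" "q powi n - 1 \<noteq> 0" using powi_ne_1[of n] qn0 by auto
    with 3 show ?thesis using qn0
      by (simp add: bilateral_coeff_def bilateral_coeff2_def power_int_minus divide_simps power2_eq_square)
         (simp add: algebra_simps)
  next
    case 4
    define u v where "u = q powi m" and "v = q powi n"
    have nz: "u \<noteq> 0" "v \<noteq> 0" using qn0 by (auto simp: u_def v_def)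
    have d: "q powi (m - n) = u / v" "q powi (n - m) = v / u"
      using qn0 by (simp_all add: u_def v_def power_int_diff)
    have "u / v \<noteq> 1" using powi_ne_1[of "m - n"] 4 d by simp
    then have "u \<noteq> v" using nz by auto
    moreover have "u \<noteq> 1" "v \<noteq> 1" using powi_ne_1 4 by (auto simp: u_def v_def)
    ultimately have "1 / (1 - u) * (1 / (1 - v)) - 1 / (1 - v) * (1 / (1 - u / v))
        - 1 / (1 - u) * (1 / (1 - v / u)) = 0"
    proof -
      assume h: "u \<noteq> v" "u \<noteq> 1" "v \<noteq> 1"
      have e: "1 / (1 - u / v) = v / (v - u)" "1 / (1 - v / u) = - u / (v - u)"
        using nz h(1) by (simp_all add: field_simps)
      have "1 - u \<noteq> 0" "1 - v \<noteq> 0" "v - u \<noteq> 0" using h by auto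
      then show ?thesis unfolding e by (simp add: divide_simps) (simp add: algebra_simps)
    qed
    with 4 show ?thesis by (simp add: bilateral_coeff_def d flip: u_def v_def)
  qed
qed

text \<open>The bound on \<open>norm (x * y)\<close> keeps all three arguments in the annulus of the
  bilateral expansions; both sides become double sums over integer pairs with weight
  \<open>M\<close>.\<close>

lemma zeta_addition:
  assumes x: "norm q < norm x" "norm x < 1" and y: "norm q < norm y" "norm y < 1"
    and xy: "norm q < norm (x * y)"
  shows "zeta0 q x * zeta0 q y - zeta0 q (x * y) * (zeta0 q x + zeta0 q y)
    = - 1 / 4 + bilateral_sum2 0 q x + bilateral_sum2 0 q y + bilateral_sum2 0 q (x * y)"
proof -
  let ?a = "bilateral_coeff q" and ?b = "bilateral_coeff2 q"
  let ?A = "\<lambda>x. zeta0 q x - 1 / 2" and ?B = "bilateral_sum2 0 q"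
  have xy1: "norm (x * y) < 1"
    using mult_strict_mono'[OF x(2) y(2)] by (simp add: norm_mult)
  have nz: "x \<noteq> 0" "y \<noteq> 0" using x y by auto
  note sa = has_sum_bilateral_coeff and sb = has_sum_bilateral_coeff2
  define M where "M = (\<lambda>(m::int, n::int). x powi m * y powi n)"
  have 1: "((\<lambda>(m, n). ?a m * ?a n * M (m, n)) has_sum (?A x * ?A y)) UNIV"
    using has_sum_product_complex[OF sa[OF x] sa[OF y]]
    by (simp add: M_def mult_ac case_prod_unfold)
  \<comment> \<open>The product of the expansions at \<open>x * y\<close> and \<open>x\<close> has
    monomials (xy)^n x^k; the substitution m = n + k turns them into x^m y^n.\<close>
  have 2: "((\<lambda>(m, n). ?a n * ?a (m - n) * M (m, n)) has_sum (?A (x * y) * ?A x)) UNIV"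
  proof -
    have "((\<lambda>(n, k). (?a n * (x * y) powi n) * (?a k * x powi k)) has_sum (?A (x * y) * ?A x)) UNIV"
      using has_sum_product_complex[OF sa[OF xy xy1] sa[OF x]] by simp
    also have "?this \<longleftrightarrow> ?thesis"
      by (rule has_sum_reindex_bij_witness[of _ "\<lambda>(m, n). (n, m - n)" "\<lambda>(n, k). (n + k, n)"])
        (use nz in \<open>auto simp: M_def power_int_add power_int_mult_distrib\<close>)
    finally show ?thesis .
  qed
  have 3: "((\<lambda>(m, n). ?a m * ?a (n - m) * M (m, n)) has_sum (?A (x * y) * ?A y)) UNIV"
  proof -
    have "((\<lambda>(m, k). (?a m * (x * y) powi m) * (?a k * y powi k)) has_sum (?A (x * y) * ?A y)) UNIV"
      using has_sum_product_complex[OF sa[OF xy xy1] sa[OF y]] by simp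
    also have "?this \<longleftrightarrow> ?thesis"
      by (rule has_sum_reindex_bij_witness[of _ "\<lambda>(m, n). (m, n - m)" "\<lambda>(m, k). (m, m + k)"])
        (use nz in \<open>auto simp: M_def power_int_add power_int_mult_distrib\<close>)
    finally show ?thesis .
  qed
  \<comment> \<open>Terms supported on the diagonal form a single series in \<open>x * y\<close>;
    terms on an axis form a series in \<open>x\<close> or \<open>y\<close> alone.\<close>
  have 4: "((\<lambda>(m, n). (if m = n then ?a n + ?b n else 0) * M (m, n)) has_sum (?A (x * y) + ?B (x * y))) UNIV"
  proof -
    have "((\<lambda>n. (?a n + ?b n) * (x * y) powi n) has_sum (?A (x * y) + ?B (x * y))) UNIV"
      using has_sum_add[OF sa[OF xy xy1] sb[OF xy xy1]] by (simp add: algebra_simps)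
    also have "?this \<longleftrightarrow> ((\<lambda>(m, n). (?a n + ?b n) * M (m, n)) has_sum (?A (x * y) + ?B (x * y))) (range (\<lambda>n. (n, n)))"
      by (subst has_sum_reindex) (auto simp: inj_on_def o_def M_def power_int_mult_distrib)
    also have "\<dots> \<longleftrightarrow> ?thesis"
      by (rule has_sum_cong_neutral) auto
    finally show ?thesis .
  qed
  have 5: "((\<lambda>(m, n). (if n = 0 then ?b m else 0) * M (m, n)) has_sum (?B x)) UNIV"
  proof -
    have "((\<lambda>n. ?b n * x powi n) has_sum ?B x) UNIV" by (rule sb[OF x])
    also have "?this \<longleftrightarrow> ((\<lambda>(m, n). ?b m * M (m, n)) has_sum ?B x) (range (\<lambda>m. (m, 0)))"
      by (subst has_sum_reindex) (auto simp: inj_on_def o_def M_def)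
    also have "\<dots> \<longleftrightarrow> ?thesis"
      by (rule has_sum_cong_neutral) auto
    finally show ?thesis .
  qed
  have 6: "((\<lambda>(m, n). (if m = 0 then ?b n else 0) * M (m, n)) has_sum (?B y)) UNIV"
  proof -
    have "((\<lambda>n. ?b n * y powi n) has_sum ?B y) UNIV" by (rule sb[OF y])
    also have "?this \<longleftrightarrow> ((\<lambda>(m, n). ?b n * M (m, n)) has_sum ?B y) (range (\<lambda>n. (0, n)))"
      by (subst has_sum_reindex) (auto simp: inj_on_def o_def M_def)
    also have "\<dots> \<longleftrightarrow> ?thesis"
      by (rule has_sum_cong_neutral) auto
    finally show ?thesis .
  qed
  let ?c = "\<lambda>(m, n). (?a m * ?a n - ?a n * ?a (m - n) - ?a m * ?a (n - m)) * M (m, n)"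
  have "(?c has_sum (?A x * ?A y + - (?A (x * y) * ?A x) + - (?A (x * y) * ?A y))) UNIV"
    using has_sum_add[OF has_sum_add[OF 1 has_sum_uminusI[OF 2]] has_sum_uminusI[OF 3]]
    by (simp add: case_prod_unfold algebra_simps)
  moreover have "(?c has_sum (?A (x * y) + ?B (x * y) + ?B x + ?B y)) UNIV"
    unfolding bilateral_coeff_partial_fractions
    using has_sum_add[OF has_sum_add[OF 4 5] 6] by (simp add: case_prod_unfold distrib_right)
  ultimately have "?A x * ?A y + - (?A (x * y) * ?A x) + - (?A (x * y) * ?A y)
      = ?A (x * y) + ?B (x * y) + ?B x + ?B y"
    using has_sum_unique by blast
  \<comment> \<open>The constant 1/2 in \<open>zeta0\<close> absorbs the linear term at
    \<open>x * y\<close>; of the constants only -1/4 remains.\<close>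
  moreover have "zeta0 q x * zeta0 q y - zeta0 q (x * y) * (zeta0 q x + zeta0 q y)
      - (- 1 / 4 + ?B x + ?B y + ?B (x * y))
    = ?A x * ?A y + - (?A (x * y) * ?A x) + - (?A (x * y) * ?A y) - (?A (x * y) + ?B (x * y) + ?B x + ?B y)"
    by (simp add: field_simps)
  ultimately show ?thesis by simp
qed

end

subsection \<open>Derivatives and boundary values\<close>

context
  fixes q :: complex
  assumes q0: "0 < norm q" and q1: "norm q < 1"
begin

lemma zeta0_has_field_derivative:
  assumes x: "norm q < norm x" "norm x \<le> 1" "x \<noteq> 1"
  shows "(zeta0 q has_field_derivative zeta1 q x / x) (at x)"
proof -
  note b = annulus_bounds[OF q0 q1 x(1,2)] and sb = summable_below_lambert[OF q0 q1]
  have "1 - x \<noteq> 0" using x(3) by auto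
  then show ?thesis unfolding zeta0_def zeta1_def using b(1)
    by (auto intro!: derivative_eq_intros euler_series_has_field_derivative[OF sb b(2,1)]
          euler_series_has_field_derivative_inverse[OF sb b(3,1)])
      (simp add: field_simps power2_eq_square)
qed

lemma zeta1_has_field_derivative:
  assumes x: "norm q < norm x" "norm x \<le> 1" "x \<noteq> 1"
  shows "(zeta1 q has_field_derivative zeta2 q x / x) (at x)"
proof -
  note b = annulus_bounds[OF q0 q1 x(1,2)] and sb = summable_below_lambert[OF q0 q1]
  have nz: "1 - x \<noteq> 0" using x(3) by auto
  have "((\<lambda>x. x / (1 - x) ^ 2) has_field_derivative (x * (1 + x) / (1 - x) ^ 3) / x) (at x)"
    using nz b(1)
    by (auto intro!: derivative_eq_intros)
      (simp add: divide_simps eval_nat_numeral, simp add: algebra_simps)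
  from DERIV_add[OF DERIV_add[OF this euler_series_has_field_derivative[OF sb b(2,1), of 1 0]]
      euler_series_has_field_derivative_inverse[OF sb b(3,1), of 1 0]]
  show ?thesis unfolding zeta1_def zeta2_def
    by (simp add: add_divide_distrib diff_divide_distrib numeral_2_eq_2)
qed

lemma isCont_euler_lambert:
  assumes x: "norm q < norm x" "norm x \<le> 1"
  shows "isCont (euler_series k (lambert_coeff q i)) x"
    "isCont (\<lambda>x. euler_series k (lambert_coeff q i) (1 / x)) x"
proof -
  note b = annulus_bounds[OF q0 q1 x(1,2)] and sb = summable_below_lambert[OF q0 q1]
  show "isCont (euler_series k (lambert_coeff q i)) x"
    by (rule DERIV_isCont[OF euler_series_has_field_derivative[OF sb b(2,1)]])
  show "isCont (\<lambda>x. euler_series k (lambert_coeff q i) (1 / x)) x"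
    by (rule DERIV_isCont[OF euler_series_has_field_derivative_inverse[OF sb b(3,1)]])
qed

lemma isCont_zeta:
  assumes x: "norm q < norm x" "norm x \<le> 1" "x \<noteq> 1"
  shows "isCont (zeta0 q) x" "isCont (zeta1 q) x" "isCont (zeta2 q) x"
proof -
  show "isCont (zeta0 q) x"
    by (rule DERIV_isCont[OF zeta0_has_field_derivative[OF x]])
  show "isCont (zeta1 q) x"
    by (rule DERIV_isCont[OF zeta1_has_field_derivative[OF x]])
  show "isCont (zeta2 q) x" unfolding zeta2_def
    using isCont_euler_lambert[OF x(1,2)] x(3) by (intro continuous_intros) auto
qed

lemma isCont_bilateral_sum2:
  assumes "norm q < norm x" "norm x \<le> 1"
  shows "isCont (bilateral_sum2 k q) x"
  unfolding bilateral_sum2_def using isCont_euler_lambert[OF assms] by (intro continuous_intros)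

lemma bilateral_sum2_has_field_derivative:
  assumes x: "norm q < norm x" "norm x \<le> 1"
  shows "(bilateral_sum2 k q has_field_derivative bilateral_sum2 (Suc k) q x / x) (at x)"
proof -
  note b = annulus_bounds[OF q0 q1 x(1,2)] and sb = summable_below_lambert[OF q0 q1]
  from DERIV_add[OF euler_series_has_field_derivative[OF sb b(2,1), of k 1]
      DERIV_cmult[OF euler_series_has_field_derivative_inverse[OF sb b(3,1), of k 1], of "(- 1) ^ k"]]
  show ?thesis unfolding bilateral_sum2_def by (simp add: add_divide_distrib diff_divide_distrib)
qed

text \<open>Here \<open>f'\<close> stands for the value of z d/dz f. This operator commutes with
  scaling the argument, so the same \<open>f'\<close> serves both factors.\<close>

lemma DERIV_mult_arg:
  assumes "(f has_field_derivative f' / (x * y)) (at (x * y))" "(x::complex) \<noteq> 0" "y \<noteq> 0"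
  shows "((\<lambda>x. f (x * y)) has_field_derivative f' / x) (at x)"
    "((\<lambda>y. f (x * y)) has_field_derivative f' / y) (at y)"
proof -
  have 1: "((\<lambda>x. x * y) has_field_derivative y) (at x)"
    and 2: "((\<lambda>y. x * y) has_field_derivative x) (at y)"
    by (auto intro!: derivative_eq_intros)
  show "((\<lambda>x. f (x * y)) has_field_derivative f' / x) (at x)"
    using DERIV_chain2[where f = f and g = "\<lambda>x. x * y", OF assms(1) 1] assms(2,3)
    by (simp add: field_simps)
  show "((\<lambda>y. f (x * y)) has_field_derivative f' / y) (at y)"
    using DERIV_chain2[where f = f and g = "\<lambda>y. x * y", OF assms(1) 2] assms(2,3)
    by (simp add: field_simps)
qed

text \<open>Apply x d/dx to \<open>zeta_addition\<close>; the term in \<open>y\<close> alone drops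
  out.\<close>

lemma zeta_addition_deriv:
  assumes x: "norm q < norm x" "norm x < 1" and y: "norm q < norm y" "norm y < 1"
    and xy: "norm q < norm (x * y)"
  shows "zeta1 q x * zeta0 q y - zeta1 q (x * y) * (zeta0 q x + zeta0 q y) - zeta0 q (x * y) * zeta1 q x
    = bilateral_sum2 1 q x + bilateral_sum2 1 q (x * y)"
proof -
  let ?S = "{x. norm q < norm x \<and> norm x < 1 \<and> norm q < norm (x * y)}"
  have nz: "x \<noteq> 0" "y \<noteq> 0" using x y by auto
  have xy1: "norm (x * y) < 1"
    using mult_strict_mono'[OF x(2) y(2)] by (simp add: norm_mult)
  have ne: "x \<noteq> 1" "x * y \<noteq> 1" using x xy1 by auto
  note dx = zeta0_has_field_derivative[OF x(1) less_imp_le[OF x(2)] ne(1)]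
  note dxy = DERIV_mult_arg(1)[OF zeta0_has_field_derivative[OF xy less_imp_le[OF xy1] ne(2)] nz]
  note tx = bilateral_sum2_has_field_derivative[OF x(1) less_imp_le[OF x(2)], of 0]
  note txy = DERIV_mult_arg(1)[OF bilateral_sum2_has_field_derivative[OF xy less_imp_le[OF xy1], of 0] nz]
  let ?l = "\<lambda>x. zeta0 q x * zeta0 q y - zeta0 q (x * y) * (zeta0 q x + zeta0 q y)"
  let ?r = "\<lambda>x. - 1 / 4 + bilateral_sum2 0 q x + bilateral_sum2 0 q y + bilateral_sum2 0 q (x * y)"
  have l: "(?l has_field_derivative (zeta1 q x * zeta0 q y - zeta1 q (x * y) * (zeta0 q x + zeta0 q y)
      - zeta0 q (x * y) * zeta1 q x) / x) (at x)"
    by (rule derivative_eq_intros dx dxy refl)+ (use nz in \<open>simp add: field_simps\<close>)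
  have r: "(?r has_field_derivative (bilateral_sum2 1 q x + bilateral_sum2 1 q (x * y)) / x) (at x)"
    by (rule derivative_eq_intros tx txy refl)+ (use nz in \<open>simp add: field_simps\<close>)
  \<comment> \<open>The identity holds on an open neighbourhood of \<open>x\<close>, so the
    derivatives of its two sides agree.\<close>
  have "open ?S"
    by (intro open_Collect_conj open_Collect_less continuous_intros)
  then have "(?r has_field_derivative (zeta1 q x * zeta0 q y - zeta1 q (x * y) * (zeta0 q x + zeta0 q y)
      - zeta0 q (x * y) * zeta1 q x) / x) (at x)"
    by (rule has_field_derivative_transform_within_open[OF l])
      (use x y xy zeta_addition[OF q0 q1] in auto)
  from DERIV_unique[OF this r] nz show ?thesis by simp
qed

text \<open>A further y d/dy removes the term in \<open>x\<close> alone.\<close>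

lemma zeta_addition_deriv2:
  assumes x: "norm q < norm x" "norm x < 1" and y: "norm q < norm y" "norm y < 1"
    and xy: "norm q < norm (x * y)"
  shows "zeta1 q x * zeta1 q y - zeta2 q (x * y) * (zeta0 q x + zeta0 q y)
      - zeta1 q (x * y) * (zeta1 q x + zeta1 q y)
    = bilateral_sum2 2 q (x * y)"
proof -
  let ?S = "{y. norm q < norm y \<and> norm y < 1 \<and> norm q < norm (x * y)}"
  have nz: "x \<noteq> 0" "y \<noteq> 0" using x y by auto
  have xy1: "norm (x * y) < 1"
    using mult_strict_mono'[OF x(2) y(2)] by (simp add: norm_mult)
  have ne: "y \<noteq> 1" "x * y \<noteq> 1" using y xy1 by auto
  note dy = zeta0_has_field_derivative[OF y(1) less_imp_le[OF y(2)] ne(1)]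
  note dxy = DERIV_mult_arg(2)[OF zeta0_has_field_derivative[OF xy less_imp_le[OF xy1] ne(2)] nz]
  note d1xy = DERIV_mult_arg(2)[OF zeta1_has_field_derivative[OF xy less_imp_le[OF xy1] ne(2)] nz]
  note txy = DERIV_mult_arg(2)[OF bilateral_sum2_has_field_derivative[OF xy less_imp_le[OF xy1], of 1] nz]
  let ?l = "\<lambda>y. zeta1 q x * zeta0 q y - zeta1 q (x * y) * (zeta0 q x + zeta0 q y) - zeta0 q (x * y) * zeta1 q x"
  let ?r = "\<lambda>y. bilateral_sum2 1 q x + bilateral_sum2 1 q (x * y)"
  let ?L = "(zeta1 q x * zeta1 q y - zeta2 q (x * y) * (zeta0 q x + zeta0 q y)
      - zeta1 q (x * y) * (zeta1 q x + zeta1 q y)) / y"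
  have l: "(?l has_field_derivative ?L) (at y)"
    by (rule derivative_eq_intros dy dxy d1xy refl)+ (use nz in \<open>simp add: field_simps\<close>)
  have r: "(?r has_field_derivative bilateral_sum2 2 q (x * y) / y) (at y)"
    by (rule derivative_eq_intros txy refl)+ (simp add: numeral_2_eq_2)
  have "open ?S"
    by (intro open_Collect_conj open_Collect_less continuous_intros)
  then have "(?r has_field_derivative ?L) (at y)"
    by (rule has_field_derivative_transform_within_open[OF l])
      (use x y xy zeta_addition_deriv in auto)
  from DERIV_unique[OF this r] nz show ?thesis by simp
qed

section \<open>The limit y -> 1 and the passage to the unit circle\<close>

lemma filterlim_of_real_at_left_1:
  "filterlim (of_real :: real \<Rightarrow> complex) (at 1) (at_left 1)"
proof -
  have "((of_real :: real \<Rightarrow> complex) \<longlongrightarrow> of_real 1) (at_left 1)"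
    by (intro tendsto_intros)
  moreover have "eventually (\<lambda>r::real. complex_of_real r \<noteq> 1) (at_left 1)"
    by (auto simp: eventually_at_filter)
  ultimately show ?thesis by (simp add: filterlim_at)
qed

text \<open>Let y -> 1 in the addition identity: the simple pole of \<open>zeta0 q y\<close> meets
  the zero of zeta(x) - zeta(xy), and their product tends to \<open>zeta1 q x\<close>.\<close>

lemma zeta1_eq_interior:
  assumes x: "norm q < norm x" "norm x < 1"
  shows "zeta1 q x - zeta0 q x ^ 2 = - 1 / 4 + 2 * bilateral_sum2 0 q x + bilateral_sum2 0 q 1"
proof -
  have nz: "x \<noteq> 0" "x \<noteq> 1" using x by auto
  let ?E = "euler_series 0 (lambert_coeff q 0)"
  have c1: "isCont ?E 1" "isCont (\<lambda>y. ?E (1 / y)) 1"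
    using isCont_euler_lambert[of 1] q1 by auto
  \<comment> \<open>This is \<open>(1 - y) * zeta0 q y\<close> with the pole cancelled; its value at
    1 is 1.\<close>
  have "isCont (\<lambda>y. (1 - y) / 2 + y + (1 - y) * (?E y - ?E (1 / y))) 1"
    using c1 by (intro continuous_intros) auto
  then have "((\<lambda>y. (1 - y) / 2 + y + (1 - y) * (?E y - ?E (1 / y))) \<longlongrightarrow> 1) (at 1)"
    unfolding isCont_def by simp
  also have "?this \<longleftrightarrow> ((\<lambda>y. (1 - y) * zeta0 q y) \<longlongrightarrow> 1) (at 1)"
    by (rule tendsto_cong) (auto simp: eventually_at_filter zeta0_def field_simps)
  finally have 1: "((\<lambda>y. (1 - y) * zeta0 q y) \<longlongrightarrow> 1) (at 1)" .
  have dx: "((\<lambda>y. zeta0 q (x * y)) has_field_derivative zeta1 q x / 1) (at 1)"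
    by (rule DERIV_mult_arg(2)) (use zeta0_has_field_derivative[of x] x nz in auto)
  then have 2: "((\<lambda>y. (zeta0 q (x * y) - zeta0 q x) / (y - 1)) \<longlongrightarrow> zeta1 q x) (at 1)"
    by (simp add: has_field_derivative_iff)
  have 3: "((\<lambda>y. zeta0 q (x * y)) \<longlongrightarrow> zeta0 q x) (at 1)"
    using DERIV_isCont[OF dx] by (simp add: isCont_def)
  have 4: "((\<lambda>y. bilateral_sum2 0 q y) \<longlongrightarrow> bilateral_sum2 0 q 1) (at 1)"
    using isCont_bilateral_sum2[of 1 0] q1 by (simp add: isCont_def)
  have "((\<lambda>y. bilateral_sum2 0 q (x * y)) has_field_derivative bilateral_sum2 1 q x / 1) (at 1)"
    by (rule DERIV_mult_arg(2)) (use bilateral_sum2_has_field_derivative[of x 0] x nz in auto)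
  then have 5: "((\<lambda>y. bilateral_sum2 0 q (x * y)) \<longlongrightarrow> bilateral_sum2 0 q x) (at 1)"
    using DERIV_isCont by (fastforce simp: isCont_def)
  \<comment> \<open>The left side of the addition identity, with zeta(y) (zeta(x) - zeta(xy))
    written as the regularised factor times a difference quotient.\<close>
  let ?l = "\<lambda>y. (1 - y) * zeta0 q y * ((zeta0 q (x * y) - zeta0 q x) / (y - 1)) - zeta0 q (x * y) * zeta0 q x"
  let ?r = "\<lambda>y. - 1 / 4 + bilateral_sum2 0 q x + bilateral_sum2 0 q y + bilateral_sum2 0 q (x * y)"
  have "(?l \<longlongrightarrow> 1 * zeta1 q x - zeta0 q x * zeta0 q x) (at 1)"
    by (intro tendsto_intros 1 2 3)
  from filterlim_compose[OF this filterlim_of_real_at_left_1]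
  have l: "((\<lambda>r. ?l (of_real r)) \<longlongrightarrow> 1 * zeta1 q x - zeta0 q x * zeta0 q x) (at_left 1)" .
  have "(?r \<longlongrightarrow> - 1 / 4 + bilateral_sum2 0 q x + bilateral_sum2 0 q 1 + bilateral_sum2 0 q x) (at 1)"
    by (intro tendsto_intros 4 5)
  from filterlim_compose[OF this filterlim_of_real_at_left_1]
  have r: "((\<lambda>r. ?r (of_real r)) \<longlongrightarrow> - 1 / 4 + bilateral_sum2 0 q x + bilateral_sum2 0 q 1 + bilateral_sum2 0 q x) (at_left 1)" .
  \<comment> \<open>Above both bounds, y = r and x y lie in the annulus.\<close>
  have "eventually (\<lambda>r. r \<in> {max (norm q) (norm q / norm x)<..<1}) (at_left (1::real))"
    by (rule eventually_at_left_real) (use x q1 nz in \<open>auto simp: divide_less_eq\<close>)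
  then have "eventually (\<lambda>r. ?l (of_real r) = ?r (of_real r)) (at_left 1)"
  proof eventually_elim
    case (elim r)
    have r: "norm q < r" "r < 1" "norm q < norm x * r"
      using elim nz by (auto simp: field_simps)
    with norm_ge_zero[of q] have "0 < r" by linarith
    note r = this r
    have "1 - complex_of_real r \<noteq> 0" using r by (metis less_irrefl of_real_1 of_real_eq_iff right_minus_eq)
    then have "?l (of_real r) = zeta0 q x * zeta0 q (of_real r)
        - zeta0 q (x * of_real r) * (zeta0 q x + zeta0 q (of_real r))"
      by (simp add: divide_simps) (simp add: algebra_simps)
    also have "\<dots> = ?r (of_real r)"
      by (rule zeta_addition[OF q0 q1 x]) (use r in \<open>auto simp: norm_mult\<close>)
    finally show ?case .
  qed
  then have "((\<lambda>r. ?r (of_real r)) \<longlongrightarrow> 1 * zeta1 q x - zeta0 q x * zeta0 q x) (at_left 1)"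
    using l tendsto_cong by fast
  from tendsto_unique[OF _ this r] show ?thesis
    by (simp add: power2_eq_square)
qed

lemma radial_limit:
  fixes h :: "complex \<Rightarrow> complex"
  assumes "isCont h x" shows "((\<lambda>r. h (of_real r * x)) \<longlongrightarrow> h x) (at_left 1)"
proof -
  have "((\<lambda>r. of_real r * x) \<longlongrightarrow> of_real 1 * x) (at_left 1)"
    by (intro tendsto_intros)
  from isCont_tendsto_compose[OF assms] this show ?thesis by simp
qed

text \<open>Apply x d/dx to \<open>zeta1_eq_interior\<close>; the constant G(1) disappears.\<close>

lemma zeta2_eq_interior:
  assumes x: "norm q < norm x" "norm x < 1"
  shows "zeta2 q x = 2 * zeta0 q x * zeta1 q x + 2 * bilateral_sum2 1 q x"
proof -
  let ?S = "{x. norm q < norm x \<and> norm x < 1}"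
  have nz: "x \<noteq> 0" "x \<noteq> 1" using x by auto
  note z0 = zeta0_has_field_derivative[OF x(1) less_imp_le[OF x(2)] nz(2)]
  note z1 = zeta1_has_field_derivative[OF x(1) less_imp_le[OF x(2)] nz(2)]
  note t = bilateral_sum2_has_field_derivative[OF x(1) less_imp_le[OF x(2)], of 0]
  let ?l = "\<lambda>x. zeta1 q x - zeta0 q x ^ 2"
  let ?r = "\<lambda>x. - 1 / 4 + 2 * bilateral_sum2 0 q x + bilateral_sum2 0 q 1"
  have l: "(?l has_field_derivative (zeta2 q x - 2 * zeta0 q x * zeta1 q x) / x) (at x)"
    by (rule derivative_eq_intros z0 z1 refl)+ (use nz in \<open>simp add: field_simps\<close>)
  have r: "(?r has_field_derivative (2 * bilateral_sum2 1 q x) / x) (at x)"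
    by (rule derivative_eq_intros t refl)+ (use nz in \<open>simp add: field_simps\<close>)
  have "open ?S"
    by (intro open_Collect_conj open_Collect_less continuous_intros)
  then have "(?r has_field_derivative (zeta2 q x - 2 * zeta0 q x * zeta1 q x) / x) (at x)"
    by (rule has_field_derivative_transform_within_open[OF l])
      (use x zeta1_eq_interior in auto)
  from DERIV_unique[OF this r] nz show ?thesis by (simp add: algebra_simps)
qed

text \<open>Carries identities from \<open>norm x < 1\<close> to the unit circle: the difference of
  the two sides vanishes on the end of a radius, hence so does its limit.\<close>

lemma tendsto_zero_radial:
  fixes h :: "real \<Rightarrow> complex"
  assumes "(h \<longlongrightarrow> l) (at_left 1)" "0 \<le> c" "c < 1" "\<And>r. 0 < r \<Longrightarrow> c < r \<Longrightarrow> r < 1 \<Longrightarrow> h r = 0"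
  shows "l = 0"
proof -
  have "eventually (\<lambda>r. r \<in> {c<..<1}) (at_left 1)"
    using assms(3) by (rule eventually_at_left_real)
  then have "eventually (\<lambda>r. h r = 0) (at_left 1)"
    by eventually_elim (use assms(2,4) in auto)
  then have "(h \<longlongrightarrow> 0) (at_left 1)"
    by (rule tendsto_eventually)
  from tendsto_unique[OF _ assms(1) this] show ?thesis by simp
qed

lemma zeta1_eq:
  assumes x: "norm x = 1" "x \<noteq> 1"
  shows "zeta1 q x = zeta0 q x ^ 2 - 1 / 4 + 2 * bilateral_sum2 0 q x + bilateral_sum2 0 q 1"
proof -
  have b: "norm q < norm x" "norm x \<le> 1" using x q1 by auto
  let ?h = "\<lambda>x. zeta1 q x - (zeta0 q x ^ 2 - 1 / 4 + 2 * bilateral_sum2 0 q x + bilateral_sum2 0 q 1)"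
  have "?h y = 0" if "norm q < norm y" "norm y < 1" for y
    using zeta1_eq_interior[OF that] by (simp add: algebra_simps)
  then have "?h (of_real r * x) = 0" if "0 < r" "norm q < r" "r < 1" for r
    using that x(1) by (simp add: norm_mult)
  moreover have "isCont ?h x"
    by (intro continuous_intros isCont_zeta isCont_bilateral_sum2 b x(2))
  ultimately have "?h x = 0"
    using tendsto_zero_radial[OF radial_limit[of x ?h] norm_ge_zero q1] by blast
  then show ?thesis by simp
qed

lemma zeta2_eq:
  assumes x: "norm x = 1" "x \<noteq> 1"
  shows "zeta2 q x = 2 * zeta0 q x * zeta1 q x + 2 * bilateral_sum2 1 q x"
proof -
  have b: "norm q < norm x" "norm x \<le> 1" using x q1 by auto
  let ?h = "\<lambda>x. zeta2 q x - (2 * zeta0 q x * zeta1 q x + 2 * bilateral_sum2 1 q x)"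
  have "?h y = 0" if "norm q < norm y" "norm y < 1" for y
    using zeta2_eq_interior[OF that] by (simp add: algebra_simps)
  then have "?h (of_real r * x) = 0" if "0 < r" "norm q < r" "r < 1" for r
    using that x(1) by (simp add: norm_mult)
  moreover have "isCont ?h x"
    by (intro continuous_intros isCont_zeta isCont_bilateral_sum2 b x(2))
  ultimately have "?h x = 0"
    using tendsto_zero_radial[OF radial_limit[of x ?h] norm_ge_zero q1] by blast
  then show ?thesis by simp
qed

text \<open>The three addition identities at y = x, continued radially. Both \<open>x\<close> and
  its square must avoid the pole at 1.\<close>

lemma zeta_duplication:
  assumes x: "norm x = 1" "x \<noteq> 1" "x ^ 2 \<noteq> 1"
  shows "zeta0 q x ^ 2 - 2 * zeta0 q (x ^ 2) * zeta0 q x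
      = - 1 / 4 + 2 * bilateral_sum2 0 q x + bilateral_sum2 0 q (x ^ 2)" (is ?A)
    and "zeta1 q x * zeta0 q x - 2 * zeta1 q (x ^ 2) * zeta0 q x - zeta0 q (x ^ 2) * zeta1 q x
      = bilateral_sum2 1 q x + bilateral_sum2 1 q (x ^ 2)" (is ?B)
    and "zeta1 q x ^ 2 - 2 * zeta2 q (x ^ 2) * zeta0 q x - 2 * zeta1 q (x ^ 2) * zeta1 q x
      = bilateral_sum2 2 q (x ^ 2)" (is ?C)
proof -
  have b: "norm q < norm x" "norm x \<le> 1" "norm q < norm (x ^ 2)" "norm (x ^ 2) \<le> 1"
    using x q1 by (auto simp: norm_power)
  \<comment> \<open>Beyond this radius the square of the argument still has norm above
    \<open>norm q\<close>.\<close>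
  let ?c = "sqrt (norm q)"
  have c: "0 \<le> ?c" "?c < 1" using q1 by auto
  have r: "norm q < norm (of_real r * x) \<and> norm (of_real r * x) < 1
      \<and> norm q < norm ((of_real r * x) * (of_real r * x))" if "?c < r" "r < 1" for r
  proof -
    have "0 < r" using that(1) c(1) by linarith
    moreover have "norm q < r * r"
      using that(1) \<open>0 < r\<close> real_sqrt_less_iff[of "norm q" "r * r"] by simp
    moreover have "r * r < r" using that(2) \<open>0 < r\<close> by simp
    ultimately have "0 < r" "norm q < r" "norm q < r * r" by linarith+
    then show ?thesis using x(1) that(2) by (simp add: norm_mult)
  qed
  have sq: "isCont (\<lambda>x. h (x ^ 2)) x" if "isCont h (x ^ 2)" for h :: "complex \<Rightarrow> complex"
  proof (rule isCont_o2[where g = h])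
    show "isCont (\<lambda>x. x ^ 2) x" by (intro continuous_intros)
  qed (rule that)
  note ci = isCont_zeta[OF b(1,2) x(2)] isCont_bilateral_sum2[OF b(1,2)]
    sq[OF isCont_zeta(1)[OF b(3,4) x(3)]] sq[OF isCont_zeta(2)[OF b(3,4) x(3)]]
    sq[OF isCont_zeta(3)[OF b(3,4) x(3)]] sq[OF isCont_bilateral_sum2[OF b(3,4)]]
  let ?h = "\<lambda>x. zeta0 q x ^ 2 - 2 * zeta0 q (x ^ 2) * zeta0 q x
      - (- 1 / 4 + 2 * bilateral_sum2 0 q x + bilateral_sum2 0 q (x ^ 2))"
  have "?h y = 0" if "norm q < norm y \<and> norm y < 1 \<and> norm q < norm (y * y)" for y
    using zeta_addition[OF q0 q1, of y y] that by (simp add: power2_eq_square algebra_simps)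
  moreover have "isCont ?h x" by (rule continuous_intros ci)+
  ultimately have "?h x = 0"
    using tendsto_zero_radial[OF radial_limit[of x ?h] c] r by blast
  then show ?A by simp
  let ?h = "\<lambda>x. zeta1 q x * zeta0 q x - 2 * zeta1 q (x ^ 2) * zeta0 q x - zeta0 q (x ^ 2) * zeta1 q x
      - (bilateral_sum2 1 q x + bilateral_sum2 1 q (x ^ 2))"
  have "?h y = 0" if "norm q < norm y \<and> norm y < 1 \<and> norm q < norm (y * y)" for y
    using zeta_addition_deriv[of y y] that by (simp add: power2_eq_square algebra_simps)
  moreover have "isCont ?h x" by (rule continuous_intros ci)+
  ultimately have "?h x = 0"
    using tendsto_zero_radial[OF radial_limit[of x ?h] c] r by blast
  then show ?B by simp
  let ?h = "\<lambda>x. zeta1 q x ^ 2 - 2 * zeta2 q (x ^ 2) * zeta0 q x - 2 * zeta1 q (x ^ 2) * zeta1 q x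
      - bilateral_sum2 2 q (x ^ 2)"
  have "?h y = 0" if "norm q < norm y \<and> norm y < 1 \<and> norm q < norm (y * y)" for y
    using zeta_addition_deriv2[of y y] that by (simp add: power2_eq_square algebra_simps)
  moreover have "isCont ?h x" by (rule continuous_intros ci)+
  ultimately have "?h x = 0"
    using tendsto_zero_radial[OF radial_limit[of x ?h] c] r by blast
  then show ?C by simp
qed

end

subsection \<open>Lambert series\<close>

text \<open>The geometric series and its derivative. The numerator is just z for
  \<open>i \<le> 1\<close>; for i = 2 it would be z (1 + z).\<close>

lemma has_sum_arith_geometric:
  fixes z :: "'a :: {real_normed_field, banach}"
  assumes "norm z < 1" "i \<le> 1"
  shows "((\<lambda>m. of_nat m ^ i * z ^ m) has_sum (z / (1 - z) ^ Suc i)) {1..}"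
proof (cases "i = 0")
  case True
  then show ?thesis using has_sum_geometric_from_1[OF assms(1)] by simp
next
  case False
  then have i: "i = 1" using assms(2) by simp
  have "summable (\<lambda>n. norm (of_nat (Suc n) * z ^ n))"
    using sums_summable[OF geometric_deriv_sums[of "norm z"]] assms(1)
    by (simp add: norm_mult norm_power del: of_nat_Suc)
  then have "((\<lambda>n. of_nat (Suc n) * z ^ n) has_sum (1 / (1 - z) ^ 2)) UNIV"
    by (rule norm_summable_imp_has_sum[OF _ geometric_deriv_sums[OF assms(1)]])
  then have "((\<lambda>n. z * (of_nat (Suc n) * z ^ n)) has_sum (z * (1 / (1 - z) ^ 2))) UNIV"
    by (rule has_sum_cmult_right)
  also have "?this \<longleftrightarrow> ?thesis"
    by (rule has_sum_reindex_bij_witness[of _ "\<lambda>m. m - 1" Suc]) (auto simp: i power2_eq_square)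
  finally show ?thesis .
qed

text \<open>Dirichlet convolution of n^i with \<open>e\<close>; for \<open>i \<le> 1\<close> these
  are the q-coefficients of the sum of e(n) q^n / (1 - q^n)^(i+1).\<close>

definition divisor_sum :: "nat \<Rightarrow> (nat \<Rightarrow> complex) \<Rightarrow> nat \<Rightarrow> complex" where
  "divisor_sum i e N = (\<Sum>d | 0 < d \<and> d dvd N. of_nat (N div d) ^ i * e d)"

text \<open>Every positive number divides 0, and a sum over an infinite set is 0 by convention; so
  the constant term is 0.\<close>

lemma divisor_sum_0 [simp]: "divisor_sum i e 0 = 0"
proof -
  have "infinite {d::nat. 0 < d}"
    by (metis (mono_tags, lifting) finite_nat_set_iff_bounded lessI mem_Collect_eq not_less_iff_gr_or_eq
        zero_less_Suc)
  then show ?thesis by (simp add: divisor_sum_def)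
qed

text \<open>Expand every Lambert term in powers q^(nm) and regroup the absolutely convergent double
  series by N = n m.\<close>

lemma has_sum_lambert:
  assumes e: "summable_below 1 e" and q: "norm q < 1" and i: "i \<le> 1"
    and S: "((\<lambda>n. e n * lambert_coeff q i n) has_sum S) UNIV"
  shows "((\<lambda>N. divisor_sum i e N * q ^ N) has_sum S) UNIV"
proof -
  define f where "f = (\<lambda>(n::nat, m::nat). e n * (of_nat m ^ i * (q ^ n) ^ m))"
  have qn: "norm (q ^ n) < 1" "norm q ^ n < 1" if "n \<in> {1..}" for n
    using that q by (auto simp: norm_power power_less_one_iff)
  have "(\<lambda>x. norm (f x)) summable_on ({1..} \<times> {1..})"
  proof (rule summable_on_SigmaI)
    fix n :: nat assume n: "n \<in> {1..}"
    have "((\<lambda>m. norm (e n) * (of_nat m ^ i * (norm q ^ n) ^ m)) has_sum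
        (norm (e n) * (norm q ^ n / (1 - norm q ^ n) ^ Suc i))) {1..}"
      by (intro has_sum_cmult_right has_sum_arith_geometric i) (use qn[OF n] in simp)
    then show "((\<lambda>m. norm (f (n, m))) has_sum
        (norm (e n) * (norm q ^ n / (1 - norm q ^ n) ^ Suc i))) {1..}"
      by (simp add: f_def norm_mult norm_power)
  next
    have "(\<lambda>n. norm (e n * q ^ n)) summable_on UNIV"
      using summable_below_abs[OF e q, of 0] by (intro norm_summable_imp_summable_on) simp
    then have "(\<lambda>n. norm (e n * q ^ n)) summable_on {1..}"
      by (rule summable_on_subset_banach) simp
    then have s: "(\<lambda>n. norm (e n * q ^ n) * (1 / (1 - norm q) ^ Suc i)) summable_on {1..}"
      by (rule summable_on_cmult_left)
    \<comment> \<open>The denominators are bounded below uniformly in n by powers of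
      \<open>1 - norm q\<close>.\<close>
    show "(\<lambda>n. norm (e n) * (norm q ^ n / (1 - norm q ^ n) ^ Suc i)) summable_on {1..}"
    proof (rule summable_on_comparison_test[OF s])
      fix n :: nat assume n: "n \<in> {1..}"
      have "norm q ^ n \<le> norm q"
        using power_decreasing[of 1 n "norm q"] q n by simp
      then have "(1 - norm q) ^ Suc i \<le> (1 - norm q ^ n) ^ Suc i"
        using q by (intro power_mono) auto
      moreover have "0 < (1 - norm q) ^ Suc i" using q by (intro zero_less_power) simp
      ultimately have "norm q ^ n / (1 - norm q ^ n) ^ Suc i \<le> norm q ^ n / (1 - norm q) ^ Suc i"
        by (intro divide_left_mono mult_pos_pos) auto
      from mult_left_mono[OF this, of "norm (e n)"]
      show "norm (e n) * (norm q ^ n / (1 - norm q ^ n) ^ Suc i)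
          \<le> norm (e n * q ^ n) * (1 / (1 - norm q) ^ Suc i)"
        by (simp add: norm_mult norm_power)
      show "0 \<le> norm (e n) * (norm q ^ n / (1 - norm q ^ n) ^ Suc i)"
        using qn(2)[OF n] by simp
    qed
  qed simp
  then have "f summable_on ({1..} \<times> {1..})"
    by (rule abs_summable_summable)
  then obtain T where T: "(f has_sum T) ({1..} \<times> {1..})"
    by (auto simp: summable_on_def)
  have "((\<lambda>n. e n * lambert_coeff q i n) has_sum T) {1..}"
  proof (rule has_sum_SigmaD[OF T])
    fix n :: nat assume n: "n \<in> {1..}"
    show "((\<lambda>m. f (n, m)) has_sum e n * lambert_coeff q i n) {1..}"
      unfolding f_def lambert_coeff_def case_prod_conv
      by (intro has_sum_cmult_right has_sum_arith_geometric qn(1)[OF n] i)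
  qed
  also have "?this \<longleftrightarrow> ((\<lambda>n. e n * lambert_coeff q i n) has_sum T) UNIV"
    by (rule has_sum_cong_neutral) (auto simp: lambert_coeff_def not_le)
  finally have "T = S" using S has_sum_unique by blast
  let ?D = "\<lambda>N::nat. {d. 0 < d \<and> d dvd N}"
  let ?g = "\<lambda>(N, d). of_nat (N div d) ^ i * e d * q ^ N"
  \<comment> \<open>The pair (n, m) corresponds to N = n m together with its divisor d = n.\<close>
  have "(f has_sum T) ({1..} \<times> {1..}) \<longleftrightarrow> (?g has_sum T) (Sigma {1..} ?D)"
    by (rule has_sum_reindex_bij_witness[of _ "\<lambda>(N, d). (d, N div d)" "\<lambda>(n, m). (n * m, n)"])
      (auto simp: f_def power_mult Suc_le_eq dvd_div_eq_0_iff elim!: dvdE)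
  with T have g: "(?g has_sum T) (Sigma {1..} ?D)" by simp
  have "((\<lambda>N. divisor_sum i e N * q ^ N) has_sum T) {1..}"
  proof (rule has_sum_SigmaD[OF g])
    fix N :: nat assume "N \<in> {1..}"
    then have "finite (?D N)" by simp
    then show "((\<lambda>d. ?g (N, d)) has_sum divisor_sum i e N * q ^ N) (?D N)"
      by (intro has_sum_finiteI) (auto simp: divisor_sum_def sum_distrib_right)
  qed
  also have "?this \<longleftrightarrow> ((\<lambda>N. divisor_sum i e N * q ^ N) has_sum T) UNIV"
    by (rule has_sum_cong_neutral) (auto simp: not_le)
  finally show ?thesis using \<open>T = S\<close> by simp
qed

lemma summable_below_unimodular:
  assumes "norm x = 1"
  shows "summable_below 1 (\<lambda>n. of_nat n ^ k * x ^ n)"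
proof -
  have "summable_below (1 / 1) (\<lambda>n. x ^ n)"
    by (rule summable_below_bounded[of _ 1]) (use assms in \<open>auto simp: norm_power\<close>)
  then show ?thesis using summable_below_euler by simp
qed

lemma euler_series_lambert_has_sum:
  assumes q: "norm q < 1" and x: "norm x = 1" and i: "i \<le> 1"
  shows "((\<lambda>N. divisor_sum i (\<lambda>n. of_nat n ^ k * x ^ n) N * q ^ N)
    has_sum euler_series k (lambert_coeff q i) x) UNIV"
proof (rule has_sum_lambert[OF summable_below_unimodular[OF x] q i])
  have "((\<lambda>n. of_nat n ^ k * lambert_coeff q i n * x ^ n) has_sum euler_series k (lambert_coeff q i) x) UNIV"
  proof (cases "q = 0")
    case True
    then have "lambert_coeff q i n = 0" for n
      by (cases "n = 0") (simp_all add: lambert_coeff_def)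
    then show ?thesis by (simp add: euler_series_def)
  next
    case False
    then show ?thesis
      using x q by (intro euler_series_has_sum[OF summable_below_lambert]) auto
  qed
  then show "((\<lambda>n. of_nat n ^ k * x ^ n * lambert_coeff q i n) has_sum euler_series k (lambert_coeff q i) x) UNIV"
    by (simp add: mult_ac)
qed

lemma summable_below_divisor_sum:
  assumes x: "norm x = 1" and i: "i \<le> 1"
  shows "summable_below 1 (divisor_sum i (\<lambda>n. of_nat n ^ k * x ^ n))"
  unfolding summable_below_def
  using euler_series_lambert_has_sum[OF _ x i] has_sum_imp_sums sums_summable by blast

text \<open>On \<open>norm x = 1\<close> the roles of \<open>x\<close> and \<open>q\<close> are
  exchanged: the result is a power series in \<open>q\<close> on the whole unit disc, hence
  differentiable in \<open>q\<close>.\<close>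

lemma euler_series_lambert:
  assumes q: "norm q < 1" and x: "norm x = 1" and i: "i \<le> 1"
  shows "euler_series k (lambert_coeff q i) x = euler_series 0 (divisor_sum i (\<lambda>n. of_nat n ^ k * x ^ n)) q"
  using has_sum_imp_sums[OF euler_series_lambert_has_sum[OF q x i]]
  by (simp add: euler_series_def sums_iff)

text \<open>From (N/d) d^(k+1) = N d^k; this is the coefficient form of the link between q d/dq of
  zeta and x d/dx of G.\<close>

lemma divisor_sum_Suc:
  "divisor_sum 1 (\<lambda>n. of_nat n ^ Suc k * x ^ n) N = of_nat N * divisor_sum 0 (\<lambda>n. of_nat n ^ k * x ^ n) N"
  unfolding divisor_sum_def sum_distrib_left
proof (rule sum.cong[OF refl])
  fix d assume "d \<in> {d. 0 < d \<and> d dvd N}"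
  then have "of_nat (N div d) * of_nat d = (of_nat N :: complex)"
    by (metis (lifting) dvd_div_mult_self mem_Collect_eq of_nat_mult)
  then show "of_nat (N div d) ^ 1 * (of_nat d ^ Suc k * x ^ d)
      = of_nat N * (of_nat (N div d) ^ 0 * (of_nat d ^ k * x ^ d))"
    by (simp add: mult.assoc[symmetric])
qed

lemma euler_series_lambert_Suc:
  assumes q: "norm q < 1" and x: "norm x = 1"
  shows "euler_series (Suc k) (lambert_coeff q 1) x = euler_series 1 (divisor_sum 0 (\<lambda>n. of_nat n ^ k * x ^ n)) q"
  unfolding euler_series_lambert[OF q x order_refl]
  by (simp only: euler_series_def divisor_sum_Suc) simp

lemma euler_series_lambert_deriv:
  assumes q: "norm q < 1" and x: "norm x = 1"
  shows "\<exists>D. ((\<lambda>q. euler_series k (lambert_coeff q 0) x) has_field_derivative D) (at q)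
    \<and> q * D = euler_series (Suc k) (lambert_coeff q 1) x"
proof -
  let ?c = "divisor_sum 0 (\<lambda>n. of_nat n ^ k * x ^ n)"
  obtain D where D: "(euler_series 0 ?c has_field_derivative D) (at q)" "q * D = euler_series (Suc 0) ?c q"
    using euler_series_deriv_ex[OF summable_below_divisor_sum[OF x] q] by blast
  have "((\<lambda>q. euler_series k (lambert_coeff q 0) x) has_field_derivative D) (at q)"
    by (rule has_field_derivative_transform_within_open[OF D(1), of "ball 0 1"])
      (use q euler_series_lambert[OF _ x] in auto)
  with D(2) show ?thesis using euler_series_lambert_Suc[OF q x] by auto
qed

text \<open>The rational part of \<open>zeta0\<close> is constant in \<open>q\<close>, and the minus
  sign at \<open>1 / x\<close> matches the one in \<open>bilateral_sum2 1\<close>.\<close>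

lemma zeta0_deriv_nome:
  assumes q: "norm q < 1" and x: "norm x = 1"
  shows "\<exists>D. ((\<lambda>q. zeta0 q x) has_field_derivative D) (at q) \<and> q * D = bilateral_sum2 1 q x"
proof -
  have x': "norm (1 / x) = 1" using x by (simp add: norm_divide)
  obtain D D' where "((\<lambda>q. euler_series 0 (lambert_coeff q 0) x) has_field_derivative D) (at q)"
      "q * D = euler_series 1 (lambert_coeff q 1) x"
      "((\<lambda>q. euler_series 0 (lambert_coeff q 0) (1 / x)) has_field_derivative D') (at q)"
      "q * D' = euler_series 1 (lambert_coeff q 1) (1 / x)"
    using euler_series_lambert_deriv[OF q x, of 0] euler_series_lambert_deriv[OF q x', of 0] by auto
  then show ?thesis unfolding zeta0_def bilateral_sum2_def
    by (intro exI[of _ "D - D'"]) (auto intro!: derivative_eq_intros simp: algebra_simps)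
qed

lemma zeta1_deriv_nome:
  assumes q: "norm q < 1" and x: "norm x = 1"
  shows "\<exists>D. ((\<lambda>q. zeta1 q x) has_field_derivative D) (at q) \<and> q * D = bilateral_sum2 2 q x"
proof -
  have x': "norm (1 / x) = 1" using x by (simp add: norm_divide)
  obtain D D' where "((\<lambda>q. euler_series 1 (lambert_coeff q 0) x) has_field_derivative D) (at q)"
      "q * D = euler_series 2 (lambert_coeff q 1) x"
      "((\<lambda>q. euler_series 1 (lambert_coeff q 0) (1 / x)) has_field_derivative D') (at q)"
      "q * D' = euler_series 2 (lambert_coeff q 1) (1 / x)"
    using euler_series_lambert_deriv[OF q x, of 1] euler_series_lambert_deriv[OF q x', of 1]
    by (auto simp: numeral_2_eq_2)
  then show ?thesis unfolding zeta1_def bilateral_sum2_def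
    by (intro exI[of _ "D + D'"]) (auto intro!: derivative_eq_intros simp: algebra_simps)
qed

subsection \<open>Fifth roots of unity\<close>

text \<open>Reduces values at w^4 = 1/w to those at w.\<close>

lemma zeta_reflect:
  assumes "x \<noteq> 0" "x \<noteq> 1"
  shows "zeta0 q (1 / x) = - zeta0 q x" "zeta1 q (1 / x) = zeta1 q x"
    "bilateral_sum2 k q (1 / x) = (- 1) ^ k * bilateral_sum2 k q x"
proof -
  have "1 / 2 + (1 / x) / (1 - 1 / x) = - (1 / 2 + x / (1 - x))"
    using assms by (simp add: divide_simps) (simp add: algebra_simps)
  then show "zeta0 q (1 / x) = - zeta0 q x" by (simp add: zeta0_def)
  have "(1 / x) / (1 - 1 / x) ^ 2 = x / (1 - x) ^ 2"
    using assms by (simp add: divide_simps power2_eq_square) (simp add: algebra_simps)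
  then show "zeta1 q (1 / x) = zeta1 q x" by (simp add: zeta1_def)
  have "(- 1 :: complex) ^ k * (- 1) ^ k = 1" by (simp flip: power_mult_distrib)
  then show "bilateral_sum2 k q (1 / x) = (- 1) ^ k * bilateral_sum2 k q x"
    by (simp add: bilateral_sum2_def distrib_left mult.assoc[symmetric])
qed

lemma E2_eq:
  assumes "norm p < 1"
  shows "E2 p = 1 - 24 * euler_series 0 (lambert_coeff p 1) 1"
proof -
  have s: "divisor_sum 1 (\<lambda>n. of_nat n ^ 0 * 1 ^ n) N = of_nat (sigma1 N)" if "N > 0" for N
  proof -
    have "divisor_sum 1 (\<lambda>n. of_nat n ^ 0 * 1 ^ n) N = (\<Sum>d | 0 < d \<and> d dvd N. of_nat (N div d))"
      by (simp add: divisor_sum_def)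
    also have "\<dots> = (\<Sum>d | 0 < d \<and> d dvd N. of_nat d)"
      by (rule sum.reindex_bij_witness[of _ "\<lambda>d. N div d" "\<lambda>d. N div d"])
        (use that in \<open>auto simp: dvd_div_eq_0_iff div_dvd_iff_mult elim!: dvdE\<close>)
    finally show ?thesis by (simp add: sigma1_def)
  qed
  have "(\<lambda>N. divisor_sum 1 (\<lambda>n. of_nat n ^ 0 * 1 ^ n) N * p ^ N) sums euler_series 0 (lambert_coeff p 1) 1"
    by (rule has_sum_imp_sums[OF euler_series_lambert_has_sum]) (use assms in auto)
  then have "(\<lambda>N. divisor_sum 1 (\<lambda>n. of_nat n ^ 0 * 1 ^ n) (Suc N) * p ^ Suc N) sums
      euler_series 0 (lambert_coeff p 1) 1"
    by (subst sums_Suc_iff) simp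
  then have "(\<lambda>N. of_nat (sigma1 (Suc N)) * p ^ Suc N) sums euler_series 0 (lambert_coeff p 1) 1"
    by (subst (asm) s) auto
  then show ?thesis unfolding E2_def by (simp add: sums_iff)
qed

lemma E2_field_differentiable:
  assumes "norm p < 1"
  shows "E2 field_differentiable (at p)"
proof -
  let ?c = "divisor_sum 1 (\<lambda>n. of_nat n ^ 0 * 1 ^ n)"
  have "summable_below 1 ?c" by (rule summable_below_divisor_sum) auto
  from euler_series_deriv_ex[OF this assms] obtain D where
    D: "(euler_series 0 ?c has_field_derivative D) (at p)" by blast
  have "((\<lambda>p. 1 - 24 * euler_series 0 ?c p) has_field_derivative 0 - 24 * D) (at p)"
    by (rule derivative_eq_intros D refl)+ simp
  then have "(E2 has_field_derivative 0 - 24 * D) (at p)"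
    by (rule has_field_derivative_transform_within_open[of _ _ _ "ball 0 1"])
      (use assms E2_eq euler_series_lambert[of _ 1 1 0] in auto)
  then show ?thesis by (auto simp: field_differentiable_def)
qed

lemma Rser_field_differentiable:
  assumes "norm q < 1"
  shows "Rser field_differentiable (at q)"
proof -
  have "norm (q ^ 5) < 1" using assms by (simp add: norm_power power_less_one_iff)
  then obtain D where D: "(E2 has_field_derivative D) (at (q ^ 5))"
    using E2_field_differentiable by (auto simp: field_differentiable_def)
  have "((\<lambda>q. q ^ 5) has_field_derivative 5 * q ^ 4) (at q)"
    by (auto intro!: derivative_eq_intros)
  from DERIV_chain2[where f = E2 and g = "\<lambda>q. q ^ 5", OF D this]
  show ?thesis unfolding Rser_def by (auto simp: field_differentiable_def)
qed

section \<open>Arithmetic of a primitive fifth root of unity\<close>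

context
  fixes w :: complex
  assumes w5: "w ^ 5 = 1" and w1: "w \<noteq> 1"
begin

lemma root5_norm: "norm w = 1"
  using power_eq_1_iff[OF w5] by simp

lemma root5_nz: "w \<noteq> 0"
  using w5 by auto

lemma root5_sum: "1 + w + w ^ 2 + w ^ 3 + w ^ 4 = 0"
proof -
  have "(w - 1) * (1 + w + w ^ 2 + w ^ 3 + w ^ 4) = w ^ 5 - 1"
    by (simp add: algebra_simps eval_nat_numeral)
  with w5 w1 show ?thesis by simp
qed

lemma root5_inverse: "1 / w = w ^ 4"
  using w5 root5_nz by (simp add: field_simps eval_nat_numeral)

lemma root5_square: "(w ^ 2) ^ 5 = 1" "w ^ 2 \<noteq> 1"
proof -
  show "(w ^ 2) ^ 5 = 1"
    by (metis mult.commute power_mult power_one w5)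
  show "w ^ 2 \<noteq> 1"
  proof
    assume "w ^ 2 = 1"
    then have "w ^ 5 = w" by (simp add: eval_nat_numeral mult.assoc[symmetric])
    with w5 w1 show False by simp
  qed
qed

lemma root5_power_mod: "w ^ n = w ^ (n mod 5)"
proof -
  have "w ^ n = w ^ (5 * (n div 5) + n mod 5)" by simp
  also have "\<dots> = (w ^ 5) ^ (n div 5) * w ^ (n mod 5)" by (simp only: power_add power_mult)
  finally show ?thesis using w5 by simp
qed

text \<open>For w = exp(2 pi i/5), s = 2 i sin(2 pi/5) and t = 2 i sin(4 pi/5). Thus s^2 and t^2 are
  linear in s t, whose square is 5.\<close>

lemma root5_quadratic:
  defines "s \<equiv> w - w ^ 4" and "t \<equiv> w ^ 2 - w ^ 3"
  shows "s ^ 2 + t ^ 2 = - 5" "s ^ 2 - t ^ 2 = s * t"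
  unfolding s_def t_def using w5 root5_sum by algebra+

text \<open>An odd function of the residue mod 5 is determined by its values at 1 and 2.\<close>

lemma root5_character:
  "w ^ d - (1 / w) ^ d = (w - w ^ 4) * (of_bool (d mod 5 = 1) - of_bool (d mod 5 = 4))
     + (w ^ 2 - w ^ 3) * (of_bool (d mod 5 = 2) - of_bool (d mod 5 = 3))"
proof -
  have 1: "(1 / w) ^ d = w ^ ((4 * (d mod 5)) mod 5)"
    unfolding root5_inverse using root5_power_mod[of "4 * d"] by (simp add: power_mult mod_mult_right_eq)
  have 2: "w ^ d = w ^ (d mod 5)" by (rule root5_power_mod)
  have "d mod 5 < 5" by simp
  then consider "d mod 5 = 0" | "d mod 5 = 1" | "d mod 5 = 2" | "d mod 5 = 3" | "d mod 5 = 4" by linarith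
  then show ?thesis unfolding 1 2 by cases simp_all
qed

lemma divisor_sum_root5:
  assumes "N > 0"
  shows "divisor_sum 0 (\<lambda>n. of_nat n ^ 0 * w ^ n) N - divisor_sum 0 (\<lambda>n. of_nat n ^ 0 * (1 / w) ^ n) N
    = (w - w ^ 4) * (of_nat (divisor_count_mod 1 5 N) - of_nat (divisor_count_mod 4 5 N))
     + (w ^ 2 - w ^ 3) * (of_nat (divisor_count_mod 2 5 N) - of_nat (divisor_count_mod 3 5 N))"
proof -
  let ?D = "{d. 0 < d \<and> d dvd N}"
  have D: "finite ?D" using assms by simp
  have c: "(\<Sum>d\<in>?D. of_bool (d mod 5 = j)) = (of_nat (divisor_count_mod j 5 N) :: complex)"
    if "j < 5" for j
  proof -
    have "?D \<inter> {d. d mod 5 = j} = {d. 0 < d \<and> d dvd N \<and> [d = j] (mod 5)}"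
      using that by (auto simp: cong_def)
    then show ?thesis using D by (simp add: divisor_count_mod_def sum_of_bool_eq)
  qed
  have "divisor_sum 0 (\<lambda>n. of_nat n ^ 0 * w ^ n) N - divisor_sum 0 (\<lambda>n. of_nat n ^ 0 * (1 / w) ^ n) N
      = (\<Sum>d\<in>?D. w ^ d - (1 / w) ^ d)"
    by (simp add: divisor_sum_def sum_subtractf)
  also have "\<dots> = (w - w ^ 4) * ((\<Sum>d\<in>?D. of_bool (d mod 5 = 1)) - (\<Sum>d\<in>?D. of_bool (d mod 5 = 4)))
     + (w ^ 2 - w ^ 3) * ((\<Sum>d\<in>?D. of_bool (d mod 5 = 2)) - (\<Sum>d\<in>?D. of_bool (d mod 5 = 3)))"
    unfolding root5_character sum.distrib sum_subtractf sum_distrib_left[symmetric] by simp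
  finally show ?thesis by (simp only: c)
qed

lemma zeta0_root5_sums:
  assumes q: "norm q < 1"
  shows "(\<lambda>n. ((w - w ^ 4) * (of_nat (divisor_count_mod 1 5 (Suc n)) - of_nat (divisor_count_mod 4 5 (Suc n)))
     + (w ^ 2 - w ^ 3) * (of_nat (divisor_count_mod 2 5 (Suc n)) - of_nat (divisor_count_mod 3 5 (Suc n)))) * q ^ Suc n)
    sums (zeta0 q w - (3 * (w - w ^ 4) + (w ^ 2 - w ^ 3)) / 10)"
proof -
  let ?d = "\<lambda>x. divisor_sum 0 (\<lambda>n. of_nat n ^ 0 * x ^ n)"
  let ?E = "euler_series 0 (lambert_coeff q 0)"
  have nz: "1 - w \<noteq> 0" using w1 by auto
  have "norm (1 / w) = 1" using root5_norm by (simp add: norm_divide)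
  then have "(\<lambda>N. ?d w N * q ^ N - ?d (1 / w) N * q ^ N) sums (?E w - ?E (1 / w))"
    using q root5_norm by (intro sums_diff has_sum_imp_sums euler_series_lambert_has_sum) auto
  then have "(\<lambda>N. ?d w (Suc N) * q ^ Suc N - ?d (1 / w) (Suc N) * q ^ Suc N) sums (?E w - ?E (1 / w))"
    by (subst sums_Suc_iff) simp
  then have "(\<lambda>N. (?d w (Suc N) - ?d (1 / w) (Suc N)) * q ^ Suc N) sums (?E w - ?E (1 / w))"
    by (simp only: left_diff_distrib)
  \<comment> \<open>The value at q = 0 in terms of s and t; the coefficients 3 and 1 are those of
    \<open>Q\<close> and \<open>P\<close> at 0.\<close>
  moreover have "1 / 2 + w / (1 - w) = (3 * (w - w ^ 4) + (w ^ 2 - w ^ 3)) / 10"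
  proof -
    have "10 * (1 / 2 * (1 - w) + w) = (3 * (w - w ^ 4) + (w ^ 2 - w ^ 3)) * (1 - w)"
      using w5 root5_sum by algebra
    then show ?thesis using nz by (simp add: divide_simps) (simp add: algebra_simps)
  qed
  moreover have "?E w - ?E (1 / w) = zeta0 q w - (1 / 2 + w / (1 - w))"
    by (simp add: zeta0_def)
  ultimately show ?thesis by (simp only: divisor_sum_root5[OF zero_less_Suc])
qed

end

text \<open>The expansions at w and w^2 form a linear system for the two divisor series, since w ->
  w^2 sends (s, t) to (t, -s). Its determinant is -(s^2 + t^2) = 5; \<open>lin\<close> is the
  inversion.\<close>

lemma Pser_Qser_eq:
  fixes w :: complex
  assumes w: "w ^ 5 = 1" "w \<noteq> 1" and q: "norm q < 1"
  shows "Pser q = - 2 * ((w ^ 2 - w ^ 3) * zeta0 q w - (w - w ^ 4) * zeta0 q (w ^ 2))"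
    "Qser q = - 2 * ((w - w ^ 4) * zeta0 q w + (w ^ 2 - w ^ 3) * zeta0 q (w ^ 2))"
proof -
  define s t where "s = w - w ^ 4" and "t = w ^ 2 - w ^ 3"
  note st = root5_quadratic(1)[OF w, folded s_def t_def]
  have st': "w ^ 2 - (w ^ 2) ^ 4 = t" "(w ^ 2) ^ 2 - (w ^ 2) ^ 3 = - s"
    unfolding s_def t_def using w(1) by algebra+
  define u where "u n = (of_nat (divisor_count_mod 1 5 (Suc n)) - of_nat (divisor_count_mod 4 5 (Suc n)) :: complex)" for n
  define v where "v n = (of_nat (divisor_count_mod 2 5 (Suc n)) - of_nat (divisor_count_mod 3 5 (Suc n)) :: complex)" for n
  define a b where "a = zeta0 q w - (3 * s + t) / 10" and "b = zeta0 q (w ^ 2) - (3 * t - s) / 10"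
  have a: "(\<lambda>n. (s * u n + t * v n) * q ^ Suc n) sums a"
    using zeta0_root5_sums[OF w q] unfolding a_def u_def v_def s_def t_def .
  have b: "(\<lambda>n. (t * u n + - s * v n) * q ^ Suc n) sums b"
    using zeta0_root5_sums[OF root5_square[OF w] q] unfolding b_def u_def v_def st' by simp
  have lin: "- (s * (s * u n + t * v n) + t * (t * u n + - s * v n)) / 5 = u n"
    "- (t * (s * u n + t * v n) - s * (t * u n + - s * v n)) / 5 = v n" for n
    using st by algebra+
  have "(\<lambda>n. - (s * ((s * u n + t * v n) * q ^ Suc n) + t * ((t * u n + - s * v n) * q ^ Suc n)) / 5)
      sums (- (s * a + t * b) / 5)"
    by (intro sums_divide sums_minus sums_add sums_mult a b)
  also have "(\<lambda>n. - (s * ((s * u n + t * v n) * q ^ Suc n) + t * ((t * u n + - s * v n) * q ^ Suc n)) / 5)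
      = (\<lambda>n. u n * q ^ Suc n)"
    by (subst (3) lin(1)[symmetric]) (simp add: algebra_simps add_divide_distrib diff_divide_distrib)
  finally have u: "(\<Sum>n. u n * q ^ Suc n) = - (s * a + t * b) / 5" by (simp add: sums_iff)
  have "(\<lambda>n. - (t * ((s * u n + t * v n) * q ^ Suc n) - s * ((t * u n + - s * v n) * q ^ Suc n)) / 5)
      sums (- (t * a - s * b) / 5)"
    by (intro sums_divide sums_minus sums_diff sums_mult a b)
  also have "(\<lambda>n. - (t * ((s * u n + t * v n) * q ^ Suc n) - s * ((t * u n + - s * v n) * q ^ Suc n)) / 5)
      = (\<lambda>n. v n * q ^ Suc n)"
    by (subst (3) lin(2)[symmetric]) (simp add: algebra_simps add_divide_distrib diff_divide_distrib)
  finally have v: "(\<Sum>n. v n * q ^ Suc n) = - (t * a - s * b) / 5" by (simp add: sums_iff)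
  have "Pser q = 1 - 2 * (t * a - s * b)"
    unfolding Pser_def v_def[symmetric] v by simp
  \<comment> \<open>The constants in \<open>a\<close> and \<open>b\<close> add -(s^2 + t^2)/10 = 1/2
    to t a - s b, cancelling the 1; the 3 of \<open>Q\<close> cancels likewise.\<close>
  also have "\<dots> = - 2 * (t * zeta0 q w - s * zeta0 q (w ^ 2))"
    using st unfolding a_def b_def by algebra
  finally show "Pser q = - 2 * ((w ^ 2 - w ^ 3) * zeta0 q w - (w - w ^ 4) * zeta0 q (w ^ 2))"
    by (simp only: s_def t_def)
  have "Qser q = 3 - 2 * (s * a + t * b)"
    unfolding Qser_def u_def[symmetric] u by simp
  also have "\<dots> = - 2 * (s * zeta0 q w + t * zeta0 q (w ^ 2))"
    using st unfolding a_def b_def by algebra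
  finally show "Qser q = - 2 * ((w - w ^ 4) * zeta0 q w + (w ^ 2 - w ^ 3) * zeta0 q (w ^ 2))"
    by (simp only: s_def t_def)
qed

text \<open>Summing over all fifth roots of unity keeps the n divisible by 5, and the Lambert
  coefficient of q at 5n is that of q^5 at n. The factors 2 reflect G(1/x) = G(x).\<close>

lemma bilateral_sum2_root5:
  fixes w :: complex
  assumes w: "w ^ 5 = 1" "w \<noteq> 1" and q: "0 < norm q" "norm q < 1"
  shows "bilateral_sum2 0 q 1 + 2 * bilateral_sum2 0 q w + 2 * bilateral_sum2 0 q (w ^ 2) = 5 / 12 * (1 - Rser q)"
proof -
  let ?E = "euler_series 0 (lambert_coeff q 1)"
  let ?T = "?E 1 + ?E w + ?E (w ^ 2) + ?E (w ^ 3) + ?E (w ^ 4)"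
  have q5: "0 < norm (q ^ 5)" "norm (q ^ 5) < 1"
    using q by (auto simp: norm_power power_less_one_iff)
  have E: "((\<lambda>n. lambert_coeff q 1 n * x ^ n) has_sum ?E x) UNIV" if "norm x = 1" for x
    using euler_series_has_sum[OF summable_below_lambert[OF q], of x 0] that q by (simp add: field_simps)
  have w5d: "1 + w ^ n + (w ^ 2) ^ n + (w ^ 3) ^ n + (w ^ 4) ^ n = 5 * of_bool (5 dvd n)" for n
  proof (cases "5 dvd n")
    case True
    then obtain m where "n = 5 * m" by blast
    then have "(w ^ k) ^ n = 1" for k
      using w(1) by (metis mult.commute mult.left_commute power_mult power_one)
    from this[of 1] this[of 2] this[of 3] this[of 4] True show ?thesis by simp
  next
    case False
    \<comment> \<open>Here w^n is itself a nontrivial fifth root of unity, so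
      \<open>root5_sum\<close> applies to it.\<close>
    have "(w ^ n) ^ 5 = 1" using w(1) by (metis mult.commute power_mult power_one)
    moreover have "w ^ n \<noteq> 1"
    proof
      assume *: "w ^ n = 1"
      have "n mod 5 < 5" "n mod 5 \<noteq> 0" using False by (auto simp: dvd_eq_mod_eq_0)
      then consider "n mod 5 = 1" | "n mod 5 = 2" | "n mod 5 = 3" | "n mod 5 = 4" by linarith
      then show False
        using * root5_power_mod[OF w, of n] w
      proof cases
        case 2 then show False using * root5_power_mod[OF w, of n] root5_square(2)[OF w] by simp
      next
        case 3
        then have "w ^ 3 = 1" using * root5_power_mod[OF w, of n] by simp
        then have "w ^ 2 = 1" using w(1) by algebra
        then show False using root5_square(2)[OF w] by simp
      next
        case 4
        then have "w ^ 4 = 1" using * root5_power_mod[OF w, of n] by simp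
        then have "w = 1" using w(1) by algebra
        then show False using w by simp
      qed auto
    qed
    ultimately have "1 + w ^ n + (w ^ n) ^ 2 + (w ^ n) ^ 3 + (w ^ n) ^ 4 = 0" by (rule root5_sum)
    then show ?thesis using False by (simp add: mult.commute flip: power_mult)
  qed
  have nw: "norm w = 1" by (rule root5_norm[OF w])
  have "((\<lambda>n. lambert_coeff q 1 n * 1 ^ n + lambert_coeff q 1 n * w ^ n + lambert_coeff q 1 n * (w ^ 2) ^ n
      + lambert_coeff q 1 n * (w ^ 3) ^ n + lambert_coeff q 1 n * (w ^ 4) ^ n) has_sum ?T) UNIV"
    by (intro has_sum_add E) (auto simp: norm_power nw)
  also have "(\<lambda>n. lambert_coeff q 1 n * 1 ^ n + lambert_coeff q 1 n * w ^ n + lambert_coeff q 1 n * (w ^ 2) ^ n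
      + lambert_coeff q 1 n * (w ^ 3) ^ n + lambert_coeff q 1 n * (w ^ 4) ^ n)
    = (\<lambda>n. lambert_coeff q 1 n * (5 * of_bool (5 dvd n)))"
    by (rule ext) (simp only: w5d[symmetric] distrib_left power_one)
  also have "(\<dots> has_sum ?T) UNIV \<longleftrightarrow> ((\<lambda>n. 5 * lambert_coeff q 1 n) has_sum ?T) (range (\<lambda>n. 5 * n))"
    by (rule has_sum_cong_neutral) auto
  also have "\<dots> \<longleftrightarrow> ((\<lambda>n. 5 * lambert_coeff (q ^ 5) 1 n) has_sum ?T) UNIV"
    by (subst has_sum_reindex) (auto simp: inj_on_def o_def lambert_coeff_def power_mult)
  finally have "((\<lambda>n. 5 * lambert_coeff (q ^ 5) 1 n) has_sum ?T) UNIV" .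
  moreover have "((\<lambda>n. 5 * lambert_coeff (q ^ 5) 1 n) has_sum 5 * euler_series 0 (lambert_coeff (q ^ 5) 1) 1) UNIV"
  proof (rule has_sum_cmult_right)
    have "norm (1 :: complex) < 1 / norm (q ^ 5)" using q5 by (simp add: field_simps)
    from euler_series_has_sum[OF summable_below_lambert[OF q5] this, of 0]
    show "(lambert_coeff (q ^ 5) 1 has_sum euler_series 0 (lambert_coeff (q ^ 5) 1) 1) UNIV" by simp
  qed
  ultimately have T: "?T = 5 * euler_series 0 (lambert_coeff (q ^ 5) 1) 1"
    using has_sum_unique by blast
  have "1 / w ^ 2 = w ^ 3"
    using w(1) root5_nz[OF w] by (simp add: field_simps flip: power_add)
  then have "bilateral_sum2 0 q 1 + 2 * bilateral_sum2 0 q w + 2 * bilateral_sum2 0 q (w ^ 2) = 2 * ?T"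
    unfolding bilateral_sum2_def by (simp add: root5_inverse[OF w])
  also have "\<dots> = 5 / 12 * (1 - Rser q)"
    unfolding T Rser_def E2_eq[OF q5(2)] by simp
  finally show ?thesis .
qed

text \<open>Duplication at w and w^2 closes up: (w^2)^2 = 1/w, which reflection returns to
  w.\<close>

lemma zeta_root5_relations:
  fixes w :: complex
  assumes w: "w ^ 5 = 1" "w \<noteq> 1" and q: "0 < norm q" "norm q < 1"
  defines "X \<equiv> zeta0 q w" and "Y \<equiv> zeta0 q (w ^ 2)"
    and "X1 \<equiv> zeta1 q w" and "Y1 \<equiv> zeta1 q (w ^ 2)"
  shows "X1 = (5 * X ^ 2 - 4 * Y ^ 2 - 12 * X * Y) / 3 - 5 / 12 * Rser q"
    and "Y1 = (5 * Y ^ 2 - 4 * X ^ 2 + 12 * X * Y) / 3 - 5 / 12 * Rser q"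
    and "bilateral_sum2 1 q w = (X1 * X - 3 * Y1 * X + X1 * Y - Y1 * Y) / 2"
    and "bilateral_sum2 1 q (w ^ 2) = (X1 * X - Y1 * X - 3 * X1 * Y + Y1 * Y) / 2"
    and "bilateral_sum2 2 q (w ^ 2) = X1 ^ 2 - 4 * (Y * Y1 + bilateral_sum2 1 q (w ^ 2)) * X - 2 * Y1 * X1"
proof -
  note w2 = root5_square[OF w] and n = root5_norm[OF w]
  have n2: "norm (w ^ 2) = 1" by (rule root5_norm[OF w2])
  have w4: "(w ^ 2) ^ 2 = 1 / w" "1 / w \<noteq> 1"
    using root5_inverse[OF w] w root5_nz[OF w] by (auto simp flip: power_mult)
  note refl = zeta_reflect[OF root5_nz[OF w] w(2)]
  note D = zeta_duplication[OF q n w(2) w2(2)]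
  note D2 = zeta_duplication[OF q n2 w2(2), unfolded w4(1) refl, OF w4(2)]
  note Z = zeta1_eq[OF q n w(2)] zeta1_eq[OF q n2 w2(2)]
  note T = bilateral_sum2_root5[OF w q]
  \<comment> \<open>The undifferentiated duplications are two linear equations for G(w) and
    G(w^2).\<close>
  have g: "3 * bilateral_sum2 0 q w = 2 * X ^ 2 - 6 * X * Y - Y ^ 2 + 1 / 4"
    "3 * bilateral_sum2 0 q (w ^ 2) = 2 * Y ^ 2 + 6 * X * Y - X ^ 2 + 1 / 4"
    using D(1) D2(1) unfolding X_def Y_def by (simp, algebra)+
  \<comment> \<open>\<open>T\<close> eliminates G(1), and this is where \<open>R\<close>
    enters.\<close>
  show "X1 = (5 * X ^ 2 - 4 * Y ^ 2 - 12 * X * Y) / 3 - 5 / 12 * Rser q"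
    "Y1 = (5 * Y ^ 2 - 4 * X ^ 2 + 12 * X * Y) / 3 - 5 / 12 * Rser q"
    using g Z T unfolding X1_def Y1_def X_def Y_def by algebra+
  show "bilateral_sum2 1 q w = (X1 * X - 3 * Y1 * X + X1 * Y - Y1 * Y) / 2"
    "bilateral_sum2 1 q (w ^ 2) = (X1 * X - Y1 * X - 3 * X1 * Y + Y1 * Y) / 2"
    using D(2) D2(2) unfolding X1_def Y1_def X_def Y_def by (simp, algebra)+
  \<comment> \<open>\<open>zeta2_eq\<close> removes \<open>zeta2\<close> at w^2. The result is q
    d/dq of \<open>Y1\<close>, from which the derivative of \<open>R\<close> is obtained.\<close>
  show "bilateral_sum2 2 q (w ^ 2) = X1 ^ 2 - 4 * (Y * Y1 + bilateral_sum2 1 q (w ^ 2)) * X - 2 * Y1 * X1"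
    unfolding X1_def Y1_def X_def Y_def D(3)[symmetric] zeta2_eq[OF q n2 w2(2)]
    by (simp add: algebra_simps)
qed


section \<open>Assembly of the differential system\<close>

lemma exists_root5: "\<exists>w :: complex. w ^ 5 = 1 \<and> w \<noteq> 1"
proof (intro exI conjI)
  show "cis (2 * pi / 5) ^ 5 = 1" by (simp add: Complex.DeMoivre)
  have "0 < sin (2 * pi / 5)" by (rule sin_gt_zero) auto
  then show "cis (2 * pi / 5) \<noteq> 1" by (auto simp: complex_eq_iff)
qed

theorem theorem1p2:
  fixes q :: complex
  assumes "norm q < 1"
  shows "Pser field_differentiable (at q) \<and>
    Qser field_differentiable (at q) \<and>
    Rser field_differentiable (at q) \<and>
    q * deriv Pser q =
      (13 * Pser q ^ 3 + 39 * Pser q ^ 2 * Qser q - 47 * Pser q * Qser q ^ 2 + 9 * Qser q ^ 3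
        + 50 * Pser q * Rser q) / 120 \<and>
    q * deriv Qser q =
      (- 9 * Pser q ^ 3 - 47 * Pser q ^ 2 * Qser q - 39 * Pser q * Qser q ^ 2 + 13 * Qser q ^ 3
        + 50 * Qser q * Rser q) / 120 \<and>
    q * deriv Rser q =
      (Pser q ^ 4 - 3 * Pser q ^ 3 * Qser q - 31 * Pser q ^ 2 * Qser q ^ 2
        + 3 * Pser q * Qser q ^ 3 + Qser q ^ 4 + 125 * Rser q ^ 2) / 300"
proof -
  obtain w :: complex where w: "w ^ 5 = 1" "w \<noteq> 1" using exists_root5 by blast
  note w2 = root5_square[OF w]
  define s t where "s = w - w ^ 4" and "t = w ^ 2 - w ^ 3"
  note st = root5_quadratic[OF w, folded s_def t_def]
  note PQ = Pser_Qser_eq[OF w, folded s_def t_def]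
  define X Y where "X q = zeta0 q w" and "Y q = zeta0 q (w ^ 2)" for q
  obtain DX where DX: "(X has_field_derivative DX) (at q)" "q * DX = bilateral_sum2 1 q w"
    using zeta0_deriv_nome[OF assms root5_norm[OF w]] unfolding X_def by blast
  obtain DY where DY: "(Y has_field_derivative DY) (at q)" "q * DY = bilateral_sum2 1 q (w ^ 2)"
    using zeta0_deriv_nome[OF assms root5_norm[OF w2]] unfolding Y_def by blast
  obtain DY1 where DY1: "((\<lambda>q. zeta1 q (w ^ 2)) has_field_derivative DY1) (at q)"
      "q * DY1 = bilateral_sum2 2 q (w ^ 2)"
    using zeta1_deriv_nome[OF assms root5_norm[OF w2]] by blast
  have "((\<lambda>q. - 2 * (t * X q - s * Y q)) has_field_derivative - 2 * (t * DX - s * DY)) (at q)"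
    by (rule derivative_eq_intros DX DY refl)+ simp
  then have P: "(Pser has_field_derivative - 2 * (t * DX - s * DY)) (at q)"
    by (rule has_field_derivative_transform_within_open[of _ _ _ "ball 0 1"])
      (use assms PQ(1) in \<open>auto simp: X_def Y_def\<close>)
  have "((\<lambda>q. - 2 * (s * X q + t * Y q)) has_field_derivative - 2 * (s * DX + t * DY)) (at q)"
    by (rule derivative_eq_intros DX DY refl)+ simp
  then have Q: "(Qser has_field_derivative - 2 * (s * DX + t * DY)) (at q)"
    by (rule has_field_derivative_transform_within_open[of _ _ _ "ball 0 1"])
      (use assms PQ(2) in \<open>auto simp: X_def Y_def\<close>)
  note R = Rser_field_differentiable[OF assms]
  have diff: "Pser field_differentiable (at q)" "Qser field_differentiable (at q)"
    using P Q by (auto simp: field_differentiable_def)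
  show ?thesis
  proof (cases "q = 0")
    \<comment> \<open>The relations at fifth roots are stated for nonzero q; at q = 0 the right
      sides vanish for the values 1, 3, 1.\<close>
    case True
    then have "Pser q = 1" "Qser q = 3" "Rser q = 1"
      by (simp_all add: Pser_def Qser_def Rser_def E2_def)
    then show ?thesis using diff R True by simp
  next
    case False
    then have q: "0 < norm q" "norm q < 1" using assms by auto
    define a b where "a = zeta1 q w" and "b = zeta1 q (w ^ 2)"
    define DR where "DR = deriv Rser q"
    have dR: "(Rser has_field_derivative DR) (at q)"
      unfolding DR_def using R by (simp add: DERIV_deriv_iff_field_differentiable)
    note rel = zeta_root5_relations[OF w q, folded X_def Y_def a_def b_def, folded DX(2) DY(2) DY1(2)]
    \<comment> \<open>\<open>R\<close> is reached indirectly: differentiate the relation for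
      \<open>zeta1 q (w ^ 2)\<close>, whose q-derivative is already known, and solve for that of
      \<open>R\<close>.\<close>
    have "((\<lambda>q. (5 * Y q ^ 2 - 4 * X q ^ 2 + 12 * X q * Y q) / 3 - 5 / 12 * Rser q) has_field_derivative
        (10 * Y q * DY - 8 * X q * DX + 12 * (DX * Y q + X q * DY)) / 3 - 5 / 12 * DR) (at q)"
      by (auto intro!: derivative_eq_intros DX(1) DY(1) dR simp: field_simps)
    then have "((\<lambda>q. zeta1 q (w ^ 2)) has_field_derivative
        (10 * Y q * DY - 8 * X q * DX + 12 * (DX * Y q + X q * DY)) / 3 - 5 / 12 * DR) (at q)"
      by (rule has_field_derivative_transform_within_open[of _ _ _ "ball 0 1 - {0}"])
        (use q zeta_root5_relations(2)[OF w] in \<open>auto simp: X_def Y_def\<close>)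
    note DY1_eq = DERIV_unique[OF this DY1(1)]
    have "q * DY1 = (10 * Y q * (q * DY) - 8 * X q * (q * DX) + 12 * (q * DX * Y q + X q * (q * DY))) / 3
        - 5 / 12 * (q * DR)"
      unfolding DY1_eq[symmetric] by (simp add: field_simps)
    then have qDR: "q * DR = 12 / 5 * ((10 * Y q * (q * DY) - 8 * X q * (q * DX)
        + 12 * (q * DX * Y q + X q * (q * DY))) / 3 - q * DY1)"
      by simp
    \<comment> \<open>\<open>m\<close> is a square root of 5, and quadratic expressions in s, t are
      linear in it.\<close>
    define x y p r m where "x = X q" and "y = Y q" and "p = Pser q" and "r = Rser q" and "m = s * t"
    define u where "u = Qser q"
    note defs = x_def y_def p_def r_def u_def
    note rel = rel[folded defs] and qDR = qDR[folded defs]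
    have pu: "p = - 2 * (t * x - s * y)" "u = - 2 * (s * x + t * y)"
      using PQ[OF assms] by (simp_all add: p_def u_def x_def y_def X_def Y_def)
    have xy: "10 * x = s * u + t * p" "10 * y = t * u - s * p"
      using pu st by algebra+
    have m: "s ^ 2 = (m - 5) / 2" "t ^ 2 = - (m + 5) / 2" "m ^ 2 = 5"
      using st unfolding m_def by algebra+
    have quad: "100 * x ^ 2 = (m - 5) / 2 * u ^ 2 + 2 * m * u * p - (m + 5) / 2 * p ^ 2"
      "100 * y ^ 2 = - (m + 5) / 2 * u ^ 2 - 2 * m * u * p + (m - 5) / 2 * p ^ 2"
      "100 * (x * y) = m * u ^ 2 - m * u * p - m * p ^ 2"
      using xy m(1,2) st(2) m_def by algebra+
    \<comment> \<open>Exactly these products appear when the derivatives of \<open>X\<close> and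
      \<open>Y\<close> are combined into those of \<open>P\<close> and \<open>Q\<close>.\<close>
    have lin: "10 * (t * x) = m * u - (m + 5) / 2 * p" "10 * (s * x) = (m - 5) / 2 * u + m * p"
      "10 * (t * y) = - (m + 5) / 2 * u - m * p" "10 * (s * y) = m * u - (m - 5) / 2 * p"
      using xy m(1,2) m_def by algebra+
    have ab: "120 * a = (- 3 * m - 1) * u ^ 2 + 12 * m * u * p + (3 * m - 1) * p ^ 2 - 50 * r"
      "120 * b = (3 * m - 1) * u ^ 2 - 12 * m * u * p + (- 3 * m - 1) * p ^ 2 - 50 * r"
      using rel(1,2) quad by algebra+
    have "q * (- 2 * (t * DX - s * DY)) = - (a - 3 * b) * (t * x) - (a - b) * (t * y)
        + (a - b) * (s * x) + (b - 3 * a) * (s * y)"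
      using rel(3,4) by algebra
    \<comment> \<open>After substitution all is polynomial in p, u, r, m; reduction by m^2 = 5
      cancels the part with m.\<close>
    then have "q * (- 2 * (t * DX - s * DY)) =
      (13 * p ^ 3 + 39 * p ^ 2 * u - 47 * p * u ^ 2 + 9 * u ^ 3 + 50 * p * r) / 120"
      using lin ab m(3) by algebra
    moreover have "q * (- 2 * (s * DX + t * DY)) = - (a - 3 * b) * (s * x) - (a - b) * (s * y)
        - (a - b) * (t * x) - (b - 3 * a) * (t * y)"
      using rel(3,4) by algebra
    then have "q * (- 2 * (s * DX + t * DY)) =
      (- 9 * p ^ 3 - 47 * p ^ 2 * u - 39 * p * u ^ 2 + 13 * u ^ 3 + 50 * u * r) / 120"
      using lin ab m(3) by algebra
    \<comment> \<open>Here x and y enter only through quadratic monomials, so \<open>quad\<close>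
      eliminates them.\<close>
    moreover have "5 * (q * DR) = 4 * (a * (8 * x ^ 2 - 9 * y ^ 2 - 29 * (x * y)) + b * (5 * (x * y) - y ^ 2)
        - 3 * a ^ 2 + 6 * a * b)"
      using qDR rel(3,4,5) by algebra
    then have "q * DR = (p ^ 4 - 3 * p ^ 3 * u - 31 * p ^ 2 * u ^ 2 + 3 * p * u ^ 3 + u ^ 4 + 125 * r ^ 2) / 300"
      using quad ab m(3) by algebra
    ultimately show ?thesis
      using diff R DERIV_imp_deriv[OF P] DERIV_imp_deriv[OF Q] by (simp add: p_def u_def r_def DR_def)
  qed
qed

end
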